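(* For $j=1,2$ let $A^{(j)}=\bigcup_{k=1}^NA^{(j)}_k\subset\mathbb{R}^2$ be an $N$-layer concentric disk with radii $r^{(j)}_1>\cdots>r^{(j)}_N>0$ and layer conductivities $\sigma^{(j)}_1,\dots,\sigma_N^{(j)}$ (see context). Let $H=\sum_{n=1}^\infty a_nr^ne^{\mathrm{i}n\theta}$ be a harmonic function in $\mathbb{R}^2$ (in polar coordinates $(r,\theta)$), where $a_n\neq0$ for every sufficiently large $n$, and let $u_j$ be the solution of $$\nabla\cdot(\sigma^{(j)}\nabla u_j)=0\ \text{ in }\mathbb{R}^2,\qquad u_j-H=\mathcal{O}(|x|^{-1})\ \text{ as }|x|\to\infty,$$ where $\sigma^{(j)}=\sigma^{(j)}_k$ in $A_k^{(j)}$ for $k=0,1,\dots,N$ with $\sigma^{(j)}_0=1$. Let $\Omega$ be a bounded domain enclosing $A^{(1)}\cup A^{(2)}$ and let $\Pi$ be an open subset of $\partial\Omega$. If $u_1=u_2$ on $\Pi$, then $$r_k^{(1)}=r_k^{(2)}\quad\text{and}\quad\sigma_k^{(1)}=\sigma_k^{(2)},\qquad k=1,2,\dots,N.$$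
   Context: $N$-layer concentric disk with radii $r_1>\cdots>r_N>0$: $A_0=\{|x|>r_1\}$, $A_k=\{r_{k+1}<|x|\le r_k\}$ for $k=1,\dots,N-1$, and $A_N=\{|x|\le r_N\}$; for $A^{(j)}$ the radii are $r_k^{(j)}$ and $A_k^{(j)}$ are the corresponding sets. The conductivities $\sigma_k^{(j)}$ are positive constants with $\sigma_0^{(j)}=1$ and $\sigma_k^{(j)}\ne\sigma_{k-1}^{(j)}$ for $k=1,\dots,N$. The equation $\nabla\cdot(\sigma^{(j)}\nabla u_j)=0$ includes the transmission conditions that $u_j$ and the flux $\sigma^{(j)}\partial u_j/\partial\nu$ are continuous across every interface $\{|x|=r_k^{(j)}\}$. Functions may be complex-valued.
   Formalization: The open subset Π of ∂Ω is assumed infinite; for empty Π, or Π made of finitely many isolated boundary points (e.g. Ω a punctured disk), the claim is false. If ∂Ω has no isolated points this just says Π is non-empty. *)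

theory Defs
  imports "HOL-Analysis.Analysis" "HOL-Library.Landau_Symbols"
begin

text \<open>
  The plane is the type \<^typ>\<open>complex\<close>, a two-dimensional Euclidean space with orthonormal basis
  \<open>1, \<i>\<close>; the point with polar coordinates \<open>(r, \<theta>)\<close> is \<^term>\<open>rcis r \<theta>\<close>. All derivatives are
  real ones.
\<close>

definition partial :: "complex \<Rightarrow> (complex \<Rightarrow> complex) \<Rightarrow> complex \<Rightarrow> complex" where
  "partial b u x = frechet_derivative u (at x) b"

definition twice_cont_diff_on :: "(complex \<Rightarrow> complex) \<Rightarrow> complex set \<Rightarrow> bool" where
  "twice_cont_diff_on u S \<longleftrightarrow>
     (\<forall>x\<in>S. u differentiable (at x)) \<and>
     (\<forall>b\<in>Basis. \<forall>x\<in>S. partial b u differentiable (at x)) \<and>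
     (\<forall>b\<in>Basis. \<forall>c\<in>Basis. continuous_on S (partial c (partial b u)))"

text \<open>\<open>div_grad \<sigma> u\<close> is \<open>\<nabla> \<cdot> (\<sigma> \<nabla>u)\<close>, evaluated pointwise.\<close>

definition div_grad :: "(complex \<Rightarrow> real) \<Rightarrow> (complex \<Rightarrow> complex) \<Rightarrow> complex \<Rightarrow> complex" where
  "div_grad \<sigma> u x = (\<Sum>b\<in>Basis. partial b (\<lambda>y. \<sigma> y *\<^sub>R partial b u y) x)"

definition harmonic_on :: "(complex \<Rightarrow> complex) \<Rightarrow> complex set \<Rightarrow> bool" where
  "harmonic_on u S \<longleftrightarrow> open S \<and> twice_cont_diff_on u S \<and>
     (\<forall>x\<in>S. (\<Sum>b\<in>Basis. partial b (partial b u) x) = 0)"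

text \<open>
  Radii are \<open>r 1 > \<dots> > r N > 0\<close> (the value \<open>r 0\<close> is irrelevant); conductivities are
  \<open>s 0, \<dots>, s N\<close>, where \<open>s 0 = 1\<close> belongs to the exterior.
\<close>

definition concentric_disk :: "nat \<Rightarrow> (nat \<Rightarrow> real) \<Rightarrow> (nat \<Rightarrow> real) \<Rightarrow> bool" where
  "concentric_disk N r s \<longleftrightarrow>
     1 \<le> N \<and> (\<forall>k\<in>{1..<N}. r (Suc k) < r k) \<and> 0 < r N \<and>
     s 0 = 1 \<and> (\<forall>k\<le>N. 0 < s k) \<and> (\<forall>k\<in>{1..N}. s k \<noteq> s (k - 1))"

definition layer :: "nat \<Rightarrow> (nat \<Rightarrow> real) \<Rightarrow> nat \<Rightarrow> complex set" where
  "layer N r k =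
     (if k = 0 then {x. r 1 < norm x}
      else if k < N then {x. r (Suc k) < norm x \<and> norm x \<le> r k}
      else if k = N then {x. norm x \<le> r N}
      else {})"

definition conductivity :: "nat \<Rightarrow> (nat \<Rightarrow> real) \<Rightarrow> (nat \<Rightarrow> real) \<Rightarrow> complex \<Rightarrow> real" where
  "conductivity N r s x = (\<Sum>k\<le>N. s k * indicator (layer N r k) x)"

text \<open>The outward unit normal at \<open>x\<close> of the circle about the origin through \<open>x\<close> is \<^term>\<open>sgn x\<close>.\<close>

definition normal_flux :: "(complex \<Rightarrow> real) \<Rightarrow> (complex \<Rightarrow> complex) \<Rightarrow> complex \<Rightarrow> complex" where
  "normal_flux \<sigma> u x = \<sigma> x *\<^sub>R frechet_derivative u (at x) (sgn x)"

text \<open>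
  Classical solutions of the transmission problem. On the interface \<open>|x| = r k\<close> the gradient of
  \<open>u\<close> need not exist; continuity of the flux means that the flux, defined off the interface,
  has a limit at each interface point, which is the same from both sides.
\<close>

definition conductivity_solution ::
    "nat \<Rightarrow> (nat \<Rightarrow> real) \<Rightarrow> (nat \<Rightarrow> real) \<Rightarrow> (complex \<Rightarrow> complex) \<Rightarrow> bool" where
  "conductivity_solution N r s u \<longleftrightarrow>
     (\<forall>k\<le>N. twice_cont_diff_on u (interior (layer N r k)) \<and>
        (\<forall>x\<in>interior (layer N r k). div_grad (conductivity N r s) u x = 0)) \<and>
     continuous_on UNIV u \<and>
     (\<forall>k\<in>{1..N}. \<forall>x\<in>sphere 0 (r k).
        \<exists>L. (normal_flux (conductivity N r s) u \<longlongrightarrow> L) (at x within - sphere 0 (r k)))"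

lemma conductivity_layer:
  assumes "concentric_disk N r s" "k \<le> N" "x \<in> layer N r k"
  shows "conductivity N r s x = s k"
proof -
  have N: "1 \<le> N" and dec: "\<And>k. k \<in> {1..<N} \<Longrightarrow> r (Suc k) < r k"
    using assms(1) by (auto simp: concentric_disk_def)
  have mono: "r j \<le> r i" if "1 \<le> i" "i \<le> j" "j \<le> N" for i j
    using that(2,3)
  proof (induction j rule: dec_induct)
    case base
    show ?case by simp
  next
    case (step n)
    then have "r (Suc n) < r n" using dec[of n] that(1) by auto
    with step show ?case by auto
  qed
  have disj: "x \<notin> layer N r j" if "x \<in> layer N r i" "i < j" "j \<le> N" for i j
    using that N mono[of "Suc i" j] by (auto simp: layer_def split: if_splits)
  have "x \<notin> layer N r j" if "j \<noteq> k" "j \<le> N" for j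
    using disj[of j k] disj[of k j] assms(2,3) that by (cases "j < k") auto
  then have "conductivity N r s x = (\<Sum>j\<le>N. if j = k then s j else 0)"
    unfolding conductivity_def using assms(3) by (intro sum.cong) auto
  then show ?thesis using assms(2) by simp
qed

end

theory Submission
  imports Defs "HOL-Complex_Analysis.Complex_Analysis"
begin

text \<open>
  For a function \<open>u\<close> that is harmonic on an annulus, \<open>\<partial>u/\<partial>z\<close> is holomorphic and \<open>\<partial>u/\<partial>(cnj z)\<close> is
  antiholomorphic, so by Cauchy's theorem the Fourier coefficient of \<open>u\<close> on the circle of radius \<open>\<rho>\<close>
  for the frequency \<open>\<plusminus> m\<close> is \<open>A * \<rho> ^ m + B / \<rho> ^ m\<close>. The interface conditions turn into linear
  equations for the pairs \<open>(A, B)\<close> of the layers. In the exterior the decay of \<open>u - H\<close> forces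
  \<open>A = 2 * pi * a m\<close> for the frequency \<open>m\<close> and \<open>u\<close> to have no negative frequencies; hence the
  difference of the two solutions is antiholomorphic there. It vanishes on an infinite subset of the
  compact boundary of \<open>\<Omega>\<close>, so it vanishes in the exterior, and the two solutions have the same
  exterior pairs \<open>(A, B)\<close>. For large \<open>m\<close> the ratio \<open>B / A\<close> is asymptotic to
  \<open>(s 0 - s 1) / (s 0 + s 1) * r 1 ^ (2 * m)\<close>, which determines \<open>r 1\<close> and \<open>s 1\<close>; the interface
  equations then determine the pairs of the next layer, and the layers are peeled off one by one.
\<close>

section \<open>Second partial derivatives and Wirtinger derivatives\<close>

text \<open>Agreement on a piece of the boundary does not suffice for harmonic functions in general:
  \<open>Re z\<close> vanishes on a whole line. The one-sided spectrum of \<open>H\<close> is what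
  makes local data enough. At a frequency m > 0 the part of \<open>u - H\<close> is B * \<rho>^(-m)
  * e^(i m \<theta>) = B / (cnj z)^m, which is antiholomorphic, and zeros of an antiholomorphic
  function cannot accumulate in a connected domain unless it vanishes there. The absence of negative
  frequencies is a uniqueness statement: an exterior mode without growing part vanishes. It rests on
  an energy identity, which also bounds B / A by the power 2m of the next radius, so that deeper
  layers are exponentially invisible at an interface. Frequency 0, whose second radial solution is a
  logarithm, is settled separately by conservation of the total flux. A further obstacle is that the
  flux is prescribed at an interface only through pointwise limits. It is extended continuously
  across the circle before its Fourier coefficients are compared from both sides. Since only the
  behaviour as m tends to infinity enters the recovery, finitely many vanishing \<open>a m\<close>
  do no harm.\<close>

lemma partial_eqI:
  assumes "(u has_derivative u') (at x)"
  shows "partial b u x = u' b"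
  using frechet_derivative_at[OF assms] by (simp add: partial_def)

lemma has_derivative_partials:
  assumes "u differentiable (at x)"
  shows "(u has_derivative (\<lambda>h. Re h *\<^sub>R partial 1 u x + Im h *\<^sub>R partial \<i> u x)) (at x)"
proof -
  have D: "(u has_derivative frechet_derivative u (at x)) (at x)"
    using assms frechet_derivative_works by blast
  then interpret bounded_linear "frechet_derivative u (at x)"
    by (rule has_derivative_bounded_linear)
  have eq: "frechet_derivative u (at x) = (\<lambda>h. Re h *\<^sub>R partial 1 u x + Im h *\<^sub>R partial \<i> u x)"
  proof
    fix h
    have "h = Re h *\<^sub>R 1 + Im h *\<^sub>R \<i>" by (simp add: complex_eq_iff)
    then have "frechet_derivative u (at x) h = frechet_derivative u (at x) (Re h *\<^sub>R 1 + Im h *\<^sub>R \<i>)"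
      by simp
    then show "frechet_derivative u (at x) h = Re h *\<^sub>R partial 1 u x + Im h *\<^sub>R partial \<i> u x"
      by (simp only: add scaleR partial_def)
  qed
  show ?thesis using D by (simp only: eq)
qed

lemma has_vector_derivative_along:
  assumes "u differentiable (at (x + t *\<^sub>R b))"
  shows "((\<lambda>t. u (x + t *\<^sub>R b)) has_vector_derivative partial b u (x + t *\<^sub>R b)) (at t)"
proof -
  have D: "(u has_derivative frechet_derivative u (at (x + t *\<^sub>R b))) (at (x + t *\<^sub>R b))"
    using assms frechet_derivative_works by blast
  then interpret bounded_linear "frechet_derivative u (at (x + t *\<^sub>R b))"
    by (rule has_derivative_bounded_linear)
  have "((\<lambda>t. u (x + t *\<^sub>R b)) has_derivative (\<lambda>h. frechet_derivative u (at (x + t *\<^sub>R b)) (h *\<^sub>R b))) (at t)"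
    by (rule has_derivative_compose[of "\<lambda>t. x + t *\<^sub>R b" _ t UNIV u, OF _ D]) (auto intro!: derivative_eq_intros)
  then show ?thesis
    by (simp add: has_vector_derivative_def partial_def scaleR)
qed

lemma inner_mvt_along:
  assumes "0 < h" and "\<And>t. 0 \<le> t \<Longrightarrow> t \<le> h \<Longrightarrow> u differentiable (at (x + t *\<^sub>R b))"
  obtains t where "0 < t" "t < h"
    "(u (x + h *\<^sub>R b) - u x) \<bullet> e = h * (partial b u (x + t *\<^sub>R b) \<bullet> e)"
proof -
  have D: "((\<lambda>t. u (x + t *\<^sub>R b) \<bullet> e) has_real_derivative partial b u (x + t *\<^sub>R b) \<bullet> e) (at t)"
    if "0 \<le> t" "t \<le> h" for t
    using bounded_linear.has_vector_derivative[OF bounded_linear_inner_left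
        has_vector_derivative_along[OF assms(2)[OF that]], of e]
    by (simp add: has_real_derivative_iff_has_vector_derivative)
  have "\<exists>t>0. t < h \<and> u (x + h *\<^sub>R b) \<bullet> e - u (x + 0 *\<^sub>R b) \<bullet> e = (h - 0) * (partial b u (x + t *\<^sub>R b) \<bullet> e)"
    by (rule MVT2[OF assms(1)]) (use D in auto)
  then show ?thesis
    using that by (auto simp: inner_diff_left)
qed

text \<open>Two mean value steps: along \<open>b\<close> for the increment
  \<open>u (y + h *\<^sub>R c) - u y\<close>, then along \<open>c\<close> for
  \<open>partial b u\<close>. The left-hand side of the equation is symmetric in \<open>b\<close>
  and \<open>c\<close>, which is the point.\<close>

lemma second_difference:
  assumes "0 < h"
    and du: "\<And>s t. 0 \<le> s \<Longrightarrow> s \<le> h \<Longrightarrow> 0 \<le> t \<Longrightarrow> t \<le> h \<Longrightarrow> u differentiable (at (x + s *\<^sub>R b + t *\<^sub>R c))"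
    and dp: "\<And>s t. 0 \<le> s \<Longrightarrow> s \<le> h \<Longrightarrow> 0 \<le> t \<Longrightarrow> t \<le> h \<Longrightarrow> partial b u differentiable (at (x + s *\<^sub>R b + t *\<^sub>R c))"
  obtains s t where "0 < s" "s < h" "0 < t" "t < h"
    "(u (x + h *\<^sub>R b + h *\<^sub>R c) - u (x + h *\<^sub>R b) - u (x + h *\<^sub>R c) + u x) \<bullet> e
       = h\<^sup>2 * (partial c (partial b u) (x + s *\<^sub>R b + t *\<^sub>R c) \<bullet> e)"
proof -
  have du0: "u differentiable (at (x + s *\<^sub>R b))" if "0 \<le> s" "s \<le> h" for s
    using du[of s 0] that assms(1) by simp
  have duh: "u differentiable (at (x + h *\<^sub>R c + s *\<^sub>R b))" if "0 \<le> s" "s \<le> h" for s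
    using du[of s h] that assms(1) by (simp add: add_ac)
  define v where "v y = u (y + h *\<^sub>R c) - u y" for y
  have shift: "((\<lambda>y. u (y + h *\<^sub>R c)) has_derivative frechet_derivative u (at (x + h *\<^sub>R c + s *\<^sub>R b)))
      (at (x + s *\<^sub>R b))" if "0 \<le> s" "s \<le> h" for s
  proof -
    have "(u has_derivative frechet_derivative u (at (x + h *\<^sub>R c + s *\<^sub>R b))) (at (x + h *\<^sub>R c + s *\<^sub>R b))"
      using duh[OF that] frechet_derivative_works by blast
    then have "(u has_derivative frechet_derivative u (at (x + h *\<^sub>R c + s *\<^sub>R b))) (at ((x + s *\<^sub>R b) + h *\<^sub>R c))"
      by (simp add: add_ac)
    then show ?thesis
      by (rule has_derivative_compose[rotated]) (auto intro!: derivative_eq_intros)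
  qed
  have v: "(v has_derivative (\<lambda>k. frechet_derivative u (at (x + h *\<^sub>R c + s *\<^sub>R b)) k
        - frechet_derivative u (at (x + s *\<^sub>R b)) k)) (at (x + s *\<^sub>R b))"
    if "0 \<le> s" "s \<le> h" for s
    unfolding v_def using du0[OF that] frechet_derivative_works
    by (intro has_derivative_diff shift that) blast
  have pv: "partial b v (x + s *\<^sub>R b) = partial b u (x + s *\<^sub>R b + h *\<^sub>R c) - partial b u (x + s *\<^sub>R b)"
    if "0 \<le> s" "s \<le> h" for s
    using partial_eqI[OF v[OF that]] by (simp add: partial_def add_ac)
  obtain s where s: "0 < s" "s < h" "(v (x + h *\<^sub>R b) - v x) \<bullet> e = h * (partial b v (x + s *\<^sub>R b) \<bullet> e)"
    using inner_mvt_along[OF assms(1), of v x b e] v by (metis differentiableI)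
  obtain t where t: "0 < t" "t < h" "(partial b u (x + s *\<^sub>R b + h *\<^sub>R c) - partial b u (x + s *\<^sub>R b)) \<bullet> e
      = h * (partial c (partial b u) (x + s *\<^sub>R b + t *\<^sub>R c) \<bullet> e)"
    using inner_mvt_along[OF assms(1), of "partial b u" "x + s *\<^sub>R b" c e] dp s by (metis less_eq_real_def)
  show ?thesis
    using that[OF s(1,2) t(1,2)] s t pv[of s] by (simp add: v_def power2_eq_square algebra_simps)
qed

text \<open>Schwarz's theorem. Computed in both orders, the second difference over a square of side
  \<open>h n\<close> equates the mixed derivatives at two nearby points; continuity carries the
  equality to \<open>x\<close>, one component at a time.\<close>

lemma partial_commute:
  assumes "open S" "twice_cont_diff_on u S" "x \<in> S"
  shows "partial \<i> (partial 1 u) x = partial 1 (partial \<i> u) x"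
proof -
  have du: "\<And>y. y \<in> S \<Longrightarrow> u differentiable (at y)"
    and dp: "\<And>y. y \<in> S \<Longrightarrow> partial 1 u differentiable (at y)"
      "\<And>y. y \<in> S \<Longrightarrow> partial \<i> u differentiable (at y)"
    and cont: "continuous_on S (partial \<i> (partial 1 u))" "continuous_on S (partial 1 (partial \<i> u))"
    using assms(2) by (auto simp: twice_cont_diff_on_def Basis_complex_def)
  obtain d where d: "d > 0" "ball x d \<subseteq> S"
    using assms(1,3) openE by blast
  \<comment> \<open>The square of side \<open>h n\<close> reaches distance at most
    \<open>2 * h n\<close> from \<open>x\<close>; the summand 3 keeps this below \<open>d\<close>
    from \<open>n = 0\<close> on.\<close>
  define h where "h n = d / (3 + real n)" for n
  have h: "0 < h n" "2 * h n < d" for n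
    using d(1) by (auto simp: h_def field_simps intro!: add_pos_nonneg)
  have h0: "h \<longlonglongrightarrow> 0"
    unfolding h_def using filterlim_tendsto_add_at_top[OF tendsto_const filterlim_real_sequentially]
    by (rule tendsto_divide_0[OF tendsto_const filterlim_at_top_imp_at_infinity])
  have close: "dist x (x + s *\<^sub>R b + t *\<^sub>R c) \<le> 2 * k"
    if "0 \<le> s" "s \<le> k" "0 \<le> t" "t \<le> k" "norm b = 1" "norm c = 1" for s t k b c
  proof -
    have "norm (s *\<^sub>R b + t *\<^sub>R c) \<le> s + t"
      by (rule order_trans[OF norm_triangle_ineq]) (use that in auto)
    moreover have "dist x (x + s *\<^sub>R b + t *\<^sub>R c) = norm (s *\<^sub>R b + t *\<^sub>R c)"
      by (metis add.assoc add_diff_cancel_left' dist_commute dist_norm)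
    ultimately show ?thesis using that by linarith
  qed
  have inS: "x + s *\<^sub>R b + t *\<^sub>R c \<in> S"
    if "0 \<le> s" "s \<le> h n" "0 \<le> t" "t \<le> h n" "norm b = 1" "norm c = 1" for s t n b c
    using close[OF that] h[of n] d(2) by (meson le_less_trans mem_ball subsetD)
  have "partial \<i> (partial 1 u) x \<bullet> e = partial 1 (partial \<i> u) x \<bullet> e" for e
  proof -
    have "\<exists>y y'. dist x y \<le> 2 * h n \<and> dist x y' \<le> 2 * h n \<and>
        partial \<i> (partial 1 u) y \<bullet> e = partial 1 (partial \<i> u) y' \<bullet> e" for n
    proof -
      obtain s t where st: "0 < s" "s < h n" "0 < t" "t < h n"
        "(u (x + h n *\<^sub>R 1 + h n *\<^sub>R \<i>) - u (x + h n *\<^sub>R 1) - u (x + h n *\<^sub>R \<i>) + u x) \<bullet> e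
          = (h n)\<^sup>2 * (partial \<i> (partial 1 u) (x + s *\<^sub>R 1 + t *\<^sub>R \<i>) \<bullet> e)"
        by (rule second_difference[OF h(1)[of n], of u x 1 \<i> e]) (use du dp inS in auto)
      obtain s' t' where st': "0 < s'" "s' < h n" "0 < t'" "t' < h n"
        "(u (x + h n *\<^sub>R \<i> + h n *\<^sub>R 1) - u (x + h n *\<^sub>R \<i>) - u (x + h n *\<^sub>R 1) + u x) \<bullet> e
          = (h n)\<^sup>2 * (partial 1 (partial \<i> u) (x + s' *\<^sub>R \<i> + t' *\<^sub>R 1) \<bullet> e)"
        by (rule second_difference[OF h(1)[of n], of u x \<i> 1 e]) (use du dp inS in auto)
      have "(h n)\<^sup>2 * (partial \<i> (partial 1 u) (x + s *\<^sub>R 1 + t *\<^sub>R \<i>) \<bullet> e)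
          = (h n)\<^sup>2 * (partial 1 (partial \<i> u) (x + s' *\<^sub>R \<i> + t' *\<^sub>R 1) \<bullet> e)"
        using st(5) st'(5) by (simp add: algebra_simps)
      then have "partial \<i> (partial 1 u) (x + s *\<^sub>R 1 + t *\<^sub>R \<i>) \<bullet> e
          = partial 1 (partial \<i> u) (x + s' *\<^sub>R \<i> + t' *\<^sub>R 1) \<bullet> e"
        using h(1)[of n] by simp
      then show ?thesis
        using close[of s "h n" t 1 \<i>] close[of s' "h n" t' \<i> 1] st st' by force
    qed
    then obtain y y' where y: "\<And>n. dist x (y n) \<le> 2 * h n" "\<And>n. dist x (y' n) \<le> 2 * h n"
      and eq: "\<And>n. partial \<i> (partial 1 u) (y n) \<bullet> e = partial 1 (partial \<i> u) (y' n) \<bullet> e"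
      by metis
    have conv: "z \<longlonglongrightarrow> x" if "\<And>n. dist x (z n) \<le> 2 * h n" for z
    proof (rule metric_tendsto_imp_tendsto)
      show "(\<lambda>n. 2 * h n) \<longlonglongrightarrow> 0" using tendsto_mult[OF tendsto_const h0, of 2] by simp
      show "\<forall>\<^sub>F n in sequentially. dist (z n) x \<le> dist (2 * h n) 0"
        using that h(1) by (simp add: dist_commute less_imp_le)
    qed
    have ins: "z n \<in> S" if "\<And>n. dist x (z n) \<le> 2 * h n" for z n
      using that[of n] h[of n] d(2) by (meson le_less_trans mem_ball subsetD)
    have "(\<lambda>n. partial \<i> (partial 1 u) (y n) \<bullet> e) \<longlonglongrightarrow> partial \<i> (partial 1 u) x \<bullet> e"
      by (intro tendsto_intros continuous_on_tendsto_compose[OF cont(1) conv[OF y(1)]] assms(3))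
        (simp add: ins[OF y(1)])
    moreover have "(\<lambda>n. partial 1 (partial \<i> u) (y' n) \<bullet> e) \<longlonglongrightarrow> partial 1 (partial \<i> u) x \<bullet> e"
      by (intro tendsto_intros continuous_on_tendsto_compose[OF cont(2) conv[OF y(2)]] assms(3))
        (simp add: ins[OF y(2)])
    ultimately show ?thesis
      unfolding eq by (rule LIMSEQ_unique)
  qed
  then show ?thesis by (metis vector_eq_rdot)
qed

definition dz :: "(complex \<Rightarrow> complex) \<Rightarrow> complex \<Rightarrow> complex" where
  "dz u x = (partial 1 u x - \<i> * partial \<i> u x) / 2"

definition dzbar :: "(complex \<Rightarrow> complex) \<Rightarrow> complex \<Rightarrow> complex" where
  "dzbar u x = (partial 1 u x + \<i> * partial \<i> u x) / 2"

lemma has_derivative_dz_dzbar: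
  assumes "u differentiable (at x)"
  shows "(u has_derivative (\<lambda>h. dz u x * h + dzbar u x * cnj h)) (at x)"
proof -
  have "dz u x * h + dzbar u x * cnj h = Re h *\<^sub>R partial 1 u x + Im h *\<^sub>R partial \<i> u x" for h
    by (simp add: dz_def dzbar_def complex_eq_iff field_simps)
  with has_derivative_partials[OF assms] show ?thesis by simp
qed

lemma cauchy_riemann_field_differentiable:
  assumes "f differentiable (at x)" "partial \<i> f x = \<i> * partial 1 f x"
  shows "f field_differentiable (at x)"
proof -
  have "(\<lambda>h. Re h *\<^sub>R partial 1 f x + Im h *\<^sub>R partial \<i> f x) = (*) (partial 1 f x)"
    by (auto simp: assms(2) fun_eq_iff complex_eq_iff)
  then show ?thesis
    using has_derivative_partials[OF assms(1)]
    by (auto simp: field_differentiable_def has_field_derivative_def)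
qed

text \<open>Once the mixed partials commute, d/d(cnj z) of \<open>dz u\<close> is a quarter of the
  Laplacian, so harmonicity is the Cauchy-Riemann equation of \<open>dz u\<close>. For
  \<open>dzbar u\<close> the conjugate equation results, hence the \<open>cnj\<close>.\<close>

lemma
  assumes "harmonic_on u S"
  shows dz_holomorphic: "dz u holomorphic_on S"
    and cnj_dzbar_holomorphic: "(\<lambda>z. cnj (dzbar u z)) holomorphic_on S"
proof -
  have *: "dz u field_differentiable (at x)" "(\<lambda>z. cnj (dzbar u z)) field_differentiable (at x)"
    if x: "x \<in> S" for x
  proof -
    define p q where "p = partial 1 u" and "q = partial \<i> u"
    have S: "open S" "twice_cont_diff_on u S"
      and lap: "partial 1 p x + partial \<i> q x = 0"
      using assms x by (auto simp: harmonic_on_def Basis_complex_def p_def q_def)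
    have dpq: "p differentiable (at x)" "q differentiable (at x)"
      using S x by (auto simp: twice_cont_diff_on_def Basis_complex_def p_def q_def)
    have com: "partial \<i> p x = partial 1 q x"
      using partial_commute[OF S x] by (simp add: p_def q_def)
    have D: "(p has_derivative frechet_derivative p (at x)) (at x)"
            "(q has_derivative frechet_derivative q (at x)) (at x)"
      using dpq frechet_derivative_works by blast+
    have 1: "(dz u has_derivative (\<lambda>h. (frechet_derivative p (at x) h - \<i> * frechet_derivative q (at x) h) / 2)) (at x)"
      unfolding dz_def p_def[symmetric] q_def[symmetric]
      by (rule derivative_eq_intros D refl | simp)+
    have 2: "((\<lambda>z. cnj (dzbar u z)) has_derivative
        (\<lambda>h. cnj ((frechet_derivative p (at x) h + \<i> * frechet_derivative q (at x) h) / 2))) (at x)"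
      unfolding dzbar_def p_def[symmetric] q_def[symmetric]
      by (rule bounded_linear.has_derivative[OF bounded_linear_cnj] derivative_eq_intros D refl | simp)+
    have lap': "partial \<i> q x = - partial 1 p x"
      using lap by (simp add: add_eq_0_iff)
    show "dz u field_differentiable (at x)"
      by (rule cauchy_riemann_field_differentiable)
        (use 1 lap' com in \<open>auto simp: differentiableI partial_eqI[OF 1] partial_def[symmetric] complex_eq_iff\<close>)
    show "(\<lambda>z. cnj (dzbar u z)) field_differentiable (at x)"
      by (rule cauchy_riemann_field_differentiable)
        (use 2 lap' com in \<open>auto simp: differentiableI partial_eqI[OF 2] partial_def[symmetric] complex_eq_iff\<close>)
  qed
  from * show "dz u holomorphic_on S" "(\<lambda>z. cnj (dzbar u z)) holomorphic_on S"
    by (auto simp: holomorphic_on_def field_differentiable_at_within)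
qed

section \<open>Fourier coefficients on circles\<close>

text \<open>The usual factor \<open>1 / (2 * pi)\<close> is left out, whence the
  \<open>2 * pi\<close> in later values.\<close>

definition circle_coeff :: "(complex \<Rightarrow> complex) \<Rightarrow> real \<Rightarrow> int \<Rightarrow> complex" where
  "circle_coeff F r n = integral {0..2*pi} (\<lambda>t. F (rcis r t) * cis (- (of_int n * t)))"

lemma continuous_on_circle:
  assumes "continuous_on (sphere 0 r) F" "0 \<le> r"
  shows "continuous_on T (\<lambda>t. F (rcis r t))"
  by (rule continuous_on_compose2[OF assms(1)]) (auto intro!: continuous_intros simp: assms(2))

lemma circle_coeff_integrable:
  assumes "continuous_on (sphere 0 r) F" "0 \<le> r"
  shows "(\<lambda>t. F (rcis r t) * cis (- (of_int n * t))) integrable_on {0..2*pi}"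
  by (intro integrable_continuous_real continuous_intros continuous_on_circle assms)

lemma circle_coeff_add:
  assumes "continuous_on (sphere 0 r) F" "continuous_on (sphere 0 r) G" "0 \<le> r"
  shows "circle_coeff (\<lambda>z. F z + G z) r n = circle_coeff F r n + circle_coeff G r n"
  unfolding circle_coeff_def
  by (subst integral_add[symmetric]) (auto intro: circle_coeff_integrable assms simp: ring_distribs)

lemma circle_coeff_diff:
  assumes "continuous_on (sphere 0 r) F" "continuous_on (sphere 0 r) G" "0 \<le> r"
  shows "circle_coeff (\<lambda>z. F z - G z) r n = circle_coeff F r n - circle_coeff G r n"
  unfolding circle_coeff_def
  by (subst integral_diff[symmetric]) (auto intro: circle_coeff_integrable assms simp: ring_distribs)

lemma circle_coeff_cmult:
  "circle_coeff (\<lambda>z. c * F z) r n = c * circle_coeff F r n"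
  by (simp add: circle_coeff_def mult.assoc)

lemma circle_coeff_cong:
  assumes "0 \<le> r" "\<And>z. norm z = r \<Longrightarrow> F z = G z"
  shows "circle_coeff F r n = circle_coeff G r n"
  unfolding circle_coeff_def by (intro integral_cong) (simp add: assms)

lemma circle_coeff_cnj:
  "circle_coeff (\<lambda>z. cnj (F z)) r n = cnj (circle_coeff F r (- n))"
  by (simp add: circle_coeff_def integral_cnj cis_cnj)

lemma norm_circle_coeff_le:
  assumes "continuous_on (sphere 0 r) F" "0 \<le> r" "\<And>z. norm z = r \<Longrightarrow> norm (F z) \<le> B"
  shows "norm (circle_coeff F r n) \<le> 2 * pi * B"
proof -
  have "norm (circle_coeff F r n) \<le> B * (2 * pi - 0)"
    unfolding circle_coeff_def
    by (rule integral_bound)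
      (auto simp: norm_mult assms intro!: continuous_intros continuous_on_circle)
  then show ?thesis by (simp add: mult.commute)
qed

text \<open>On the circle dz = i z dt, which explains the exponent \<open>- n - 1\<close>. For
  \<open>F\<close> holomorphic on an annulus this is 2 pi i times the n-th Laurent coefficient, so
  Cauchy's theorem controls how circle coefficients depend on the radius.\<close>

lemma contour_integral_circle_coeff:
  assumes "0 < r"
  shows "contour_integral (circlepath 0 r) (\<lambda>z. F z * z powi (- n - 1)) = \<i> * circle_coeff F r n / complex_of_real r powi n"
proof -
  have "F (r * cis t) * (r * cis t) powi (- n - 1) * r * \<i> * cis t
      = (\<i> / complex_of_real r powi n) * (F (rcis r t) * cis (- (of_int n * t)))" for t
  proof -
    have "(r * cis t) powi (- n - 1) * (r * cis t) = (r * cis t) powi (- n)"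
      using power_int_add_1[of "r * cis t" "- n - 1"] assms by simp
    also have "\<dots> = cis (- (of_int n * t)) / complex_of_real r powi n"
      by (simp add: power_int_mult_distrib cis_power_int power_int_minus[of "complex_of_real r"] divide_inverse mult_ac)
    finally have *: "(r * cis t) powi (- n - 1) * (r * cis t) = cis (- (of_int n * t)) / complex_of_real r powi n" .
    have "F (r * cis t) * (r * cis t) powi (- n - 1) * r * \<i> * cis t
        = \<i> * F (r * cis t) * ((r * cis t) powi (- n - 1) * (r * cis t))"
      by (simp only: mult_ac)
    then show ?thesis unfolding * by (simp add: rcis_def)
  qed
  then show ?thesis
    unfolding circlepath_def circle_coeff_def
    by (simp add: contour_integral_part_circlepath_eq)
qed

text \<open>The linear homotopy between the circles moves each point radially, so it stays in the
  closed annulus between them and avoids 0, where the power of \<open>z\<close> may be singular.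
  \<open>closed_segment\<close> leaves the order of \<open>p\<close> and \<open>r\<close>
  open.\<close>

lemma circle_coeff_holomorphic:
  assumes "F holomorphic_on S" "open S" "0 < p" "0 < r"
    and S: "\<And>z. norm z \<in> closed_segment p r \<Longrightarrow> z \<in> S"
  shows "circle_coeff F r n / complex_of_real r powi n = circle_coeff F p n / complex_of_real p powi n"
proof -
  have pos: "0 < c" if "c \<in> closed_segment p r" for c
    using that assms(3,4) by (auto simp: closed_segment_eq_real_ivl split: if_splits)
  have "contour_integral (circlepath 0 r) (\<lambda>z. F z * z powi (- n - 1))
      = contour_integral (circlepath 0 p) (\<lambda>z. F z * z powi (- n - 1))"
  proof (rule Cauchy_theorem_homotopic_loops[of "S - {0}"])
    show "homotopic_loops (S - {0}) (circlepath 0 r) (circlepath 0 p)"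
    proof (rule homotopic_loops_linear)
      fix t :: real
      show "closed_segment (circlepath 0 r t) (circlepath 0 p t) \<subseteq> S - {0}"
      proof
        fix z assume "z \<in> closed_segment (circlepath 0 r t) (circlepath 0 p t)"
        then obtain v where v: "0 \<le> v" "v \<le> 1"
          "z = (1 - v) *\<^sub>R circlepath 0 r t + v *\<^sub>R circlepath 0 p t"
          by (auto simp: closed_segment_def)
        define c where "c = (1 - v) * r + v * p"
        have "c \<in> closed_segment r p" using v by (auto simp: closed_segment_def c_def)
        then have c: "c \<in> closed_segment p r" by (simp add: closed_segment_commute)
        have "z = of_real c * exp (2 * of_real pi * \<i> * of_real t)"
          by (simp add: v(3) circlepath c_def scaleR_conv_of_real algebra_simps)
        moreover have "norm (exp (2 * of_real pi * \<i> * of_real t)) = 1"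
          by (simp add: norm_exp_eq_Re)
        ultimately have "norm z = c" using pos[OF c] by (simp add: norm_mult)
        then show "z \<in> S - {0}" using S c pos[OF c] by auto
      qed
    qed auto
  qed (use assms in \<open>auto intro!: holomorphic_intros intro: holomorphic_on_subset\<close>)
  then have "\<i> * (circle_coeff F r n / complex_of_real r powi n) = \<i> * (circle_coeff F p n / complex_of_real p powi n)"
    using assms(3,4) by (simp add: contour_integral_circle_coeff)
  then show ?thesis by (simp del: times_divide_eq_right)
qed

text \<open>The factor \<open>z\<close> lowers the pole order by one: the integrand becomes
  \<open>f z * z ^ nat (- n)\<close>, so \<open>n = 0\<close> is covered as well.\<close>

lemma circle_coeff_disc:
  assumes "f holomorphic_on ball 0 e" "0 < r" "r < e" "n \<le> 0"
  shows "circle_coeff (\<lambda>z. z * f z) r n = 0"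
proof -
  have "((\<lambda>z. f z * z ^ nat (- n)) has_contour_integral 0) (circlepath 0 r)"
    by (rule Cauchy_theorem_disc_simple[of _ 0 e])
      (use assms in \<open>auto intro!: holomorphic_intros simp: dist_norm\<close>)
  then have "contour_integral (circlepath 0 r) (\<lambda>z. f z * z ^ nat (- n)) = 0"
    by (rule contour_integral_unique)
  moreover have "contour_integral (circlepath 0 r) (\<lambda>z. f z * z ^ nat (- n))
      = contour_integral (circlepath 0 r) (\<lambda>z. z * f z * z powi (- n - 1))"
  proof (rule contour_integral_eq)
    fix z assume "z \<in> path_image (circlepath 0 r)"
    then have "z \<noteq> 0" using assms(2) by auto
    then have "z powi (- n - 1) * z = z powi (- n)"
      using power_int_add_1[of z "- n - 1"] by simp
    moreover have "z powi (- n) = z ^ nat (- n)"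
      using assms(4) by (simp add: power_int_def)
    ultimately have "z ^ nat (- n) = z powi (- n - 1) * z" by simp
    then show "f z * z ^ nat (- n) = z * f z * z powi (- n - 1)"
      by (simp only: mult_ac)
  qed
  ultimately show ?thesis
    using assms(2) by (simp add: contour_integral_circle_coeff)
qed

lemma has_vector_derivative_rcis:
  "(rcis r has_vector_derivative \<i> * rcis r t) (at t within T)"
proof -
  have "((\<lambda>t. of_real r * cis t) has_vector_derivative \<i> * rcis r t) (at t within T)"
    unfolding has_vector_derivative_def
    by (auto intro!: derivative_eq_intros simp: rcis_def scaleR_conv_of_real)
  then show ?thesis by (simp add: rcis_def[abs_def])
qed

lemma has_vector_derivative_on_circle:
  assumes "u differentiable (at (rcis r t))"
  shows "((\<lambda>t. u (rcis r t)) has_vector_derivative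
    \<i> * (rcis r t * dz u (rcis r t) - cnj (rcis r t) * dzbar u (rcis r t))) (at t within T)"
proof -
  have "((\<lambda>t. u (rcis r t)) has_derivative
      (\<lambda>h. dz u (rcis r t) * (h *\<^sub>R (\<i> * rcis r t)) + dzbar u (rcis r t) * cnj (h *\<^sub>R (\<i> * rcis r t))))
      (at t within T)"
    by (rule has_derivative_compose[of "rcis r" _ t T u, OF _ has_derivative_dz_dzbar[OF assms]])
      (rule has_vector_derivative_rcis[unfolded has_vector_derivative_def])
  then show ?thesis
    by (simp add: has_vector_derivative_def algebra_simps scaleR_conv_of_real)
qed

text \<open>Integration by parts over a full period: the angular derivative of \<open>u\<close> is
  \<open>\<i> * (z * dz u z - cnj z * dzbar u z)\<close>, and the boundary terms cancel by
  periodicity.\<close>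

lemma circle_coeff_tangential:
  assumes u: "\<And>z. norm z = r \<Longrightarrow> u differentiable (at z)" and "0 \<le> r"
    and c: "continuous_on (sphere 0 r) (dz u)" "continuous_on (sphere 0 r) (dzbar u)"
  shows "of_int n * circle_coeff u r n =
    circle_coeff (\<lambda>z. z * dz u z) r n - circle_coeff (\<lambda>z. cnj z * dzbar u z) r n"
proof -
  define T where "T z = z * dz u z - cnj z * dzbar u z" for z
  have T: "continuous_on (sphere 0 r) T"
    unfolding T_def by (intro continuous_intros c)
  have cu: "continuous_on (sphere 0 r) u"
    using u by (auto intro!: continuous_at_imp_continuous_on differentiable_imp_continuous_within)
  have D: "((\<lambda>t. u (rcis r t) * cis (- (of_int n * t))) has_vector_derivative
      \<i> * (T (rcis r t) * cis (- (of_int n * t)))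
        - \<i> * of_int n * (u (rcis r t) * cis (- (of_int n * t)))) (at t within {0..2*pi})" for t
  proof -
    have "((\<lambda>t. cis (- (of_int n * t))) has_vector_derivative - \<i> * of_int n * cis (- (of_int n * t)))
        (at t within {0..2*pi})"
      unfolding has_vector_derivative_def
      by (auto intro!: derivative_eq_intros simp: scaleR_conv_of_real)
    moreover have "((\<lambda>t. u (rcis r t)) has_vector_derivative \<i> * T (rcis r t)) (at t within {0..2*pi})"
      unfolding T_def by (rule has_vector_derivative_on_circle) (simp add: u \<open>0 \<le> r\<close>)
    ultimately show ?thesis
      using has_vector_derivative_mult[of "\<lambda>t. u (rcis r t)" "\<i> * T (rcis r t)" t "{0..2*pi}"
          "\<lambda>t. cis (- (of_int n * t))" "- \<i> * of_int n * cis (- (of_int n * t))"]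
      by (simp add: algebra_simps)
  qed
  have per: "rcis r (2 * pi) = rcis r 0" "cis (- (of_int n * (2 * pi))) = 1"
    using cis_multiple_2pi[of "- of_int n"] cis_multiple_2pi[of 1] by (simp_all add: rcis_def mult_ac)
  have "((\<lambda>t. \<i> * (T (rcis r t) * cis (- (of_int n * t)))
        - \<i> * of_int n * (u (rcis r t) * cis (- (of_int n * t)))) has_integral 0) {0..2*pi}"
    using fundamental_theorem_of_calculus[OF _ D] unfolding per by simp
  moreover have "((\<lambda>t. \<i> * (T (rcis r t) * cis (- (of_int n * t)))
        - \<i> * of_int n * (u (rcis r t) * cis (- (of_int n * t)))) has_integral
      (\<i> * circle_coeff T r n - \<i> * of_int n * circle_coeff u r n)) {0..2*pi}"
    unfolding circle_coeff_def
    by (intro has_integral_diff has_integral_mult_right integrable_integral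
        circle_coeff_integrable T cu \<open>0 \<le> r\<close>)
  ultimately have "\<i> * circle_coeff T r n - \<i> * of_int n * circle_coeff u r n = 0"
    by (rule has_integral_unique[symmetric])
  then have "circle_coeff T r n = of_int n * circle_coeff u r n"
    by (simp add: mult.assoc)
  moreover have "circle_coeff T r n
      = circle_coeff (\<lambda>z. z * dz u z) r n - circle_coeff (\<lambda>z. cnj z * dzbar u z) r n"
    unfolding T_def by (intro circle_coeff_diff continuous_intros c \<open>0 \<le> r\<close>)
  ultimately show ?thesis by simp
qed

text \<open>On the circle, \<open>r\<close> times the radial derivative is the Euler operator
  \<open>z * dz u z + cnj z * dzbar u z\<close>. Hence the same two coefficients describe both the
  values and the flux.\<close>

lemma circle_coeff_radial:
  assumes u: "\<And>z. norm z = r \<Longrightarrow> u differentiable (at z)" and "0 < r"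
    and c: "continuous_on (sphere 0 r) (dz u)" "continuous_on (sphere 0 r) (dzbar u)"
  shows "r * circle_coeff (\<lambda>z. frechet_derivative u (at z) (sgn z)) r n =
    circle_coeff (\<lambda>z. z * dz u z) r n + circle_coeff (\<lambda>z. cnj z * dzbar u z) r n"
proof -
  have "r * frechet_derivative u (at z) (sgn z) = z * dz u z + cnj z * dzbar u z" if "norm z = r" for z
    using that \<open>0 < r\<close> frechet_derivative_at[OF has_derivative_dz_dzbar[OF u[OF that]], symmetric]
    by (auto simp: sgn_div_norm scaleR_conv_of_real field_simps)
  then have "r * circle_coeff (\<lambda>z. frechet_derivative u (at z) (sgn z)) r n
      = circle_coeff (\<lambda>z. z * dz u z + cnj z * dzbar u z) r n"
    unfolding circle_coeff_cmult[symmetric] using \<open>0 < r\<close> by (intro circle_coeff_cong) auto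
  also have "\<dots> = circle_coeff (\<lambda>z. z * dz u z) r n + circle_coeff (\<lambda>z. cnj z * dzbar u z) r n"
    using \<open>0 < r\<close> by (intro circle_coeff_add continuous_intros c) auto
  finally show ?thesis .
qed

text \<open>The set \<open>I\<close> of radii is an annulus or, if it contains \<open>0\<close>, a disk, where the singular coefficients vanish.\<close>

lemma harmonic_circle_coeffs:
  assumes u: "harmonic_on u {z. norm z \<in> I}" and I: "is_interval I"
  obtains \<alpha> \<beta> :: complex where
    "\<And>r. r \<in> I \<Longrightarrow> 0 < r \<Longrightarrow> circle_coeff (\<lambda>z. z * dz u z) r n = \<alpha> * complex_of_real r powi n"
    "\<And>r. r \<in> I \<Longrightarrow> 0 < r \<Longrightarrow> of_int n * circle_coeff u r n = \<alpha> * complex_of_real r powi n - \<beta> * complex_of_real r powi (- n)"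
    "\<And>r. r \<in> I \<Longrightarrow> 0 < r \<Longrightarrow> complex_of_real r * circle_coeff (\<lambda>z. frechet_derivative u (at z) (sgn z)) r n
        = \<alpha> * complex_of_real r powi n + \<beta> * complex_of_real r powi (- n)"
    "0 \<in> I \<Longrightarrow> n \<le> 0 \<Longrightarrow> \<alpha> = 0"
    "0 \<in> I \<Longrightarrow> 0 \<le> n \<Longrightarrow> \<beta> = 0"
proof (cases "\<exists>r\<in>I. 0 < r")
  case False
  then show ?thesis using that[of 0 0] by auto
next
  case True
  define S where "S = {z :: complex. norm z \<in> I}"
  have S: "open S" "harmonic_on u S" using u by (auto simp: S_def harmonic_on_def)
  have hol: "dz u holomorphic_on S" "(\<lambda>z. cnj (dzbar u z)) holomorphic_on S"
    using dz_holomorphic[OF S(2)] cnj_dzbar_holomorphic[OF S(2)] by auto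
  have cont: "continuous_on S (dz u)" "continuous_on S (dzbar u)"
    using hol[THEN holomorphic_on_imp_continuous_on] continuous_on_cnj[of S "\<lambda>z. cnj (dzbar u z)"]
    by auto
  have cont_r: "continuous_on (sphere 0 r) (dz u)" "continuous_on (sphere 0 r) (dzbar u)"
    if "r \<in> I" for r
    using that by (auto intro: continuous_on_subset[OF cont(1)] continuous_on_subset[OF cont(2)] simp: S_def)
  have diff: "u differentiable (at z)" if "norm z \<in> I" for z
    using that u by (auto simp: harmonic_on_def twice_cont_diff_on_def)
  have seg: "z \<in> S" if "norm z \<in> closed_segment p r" "p \<in> I" "r \<in> I" for p r z
    using that I closed_segment_subset[of p I r] by (auto simp: S_def is_interval_convex_1)
  have scale: "circle_coeff (\<lambda>z. z * h z) r m / complex_of_real r powi m = circle_coeff (\<lambda>z. z * h z) p m / complex_of_real p powi m"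
    if "h holomorphic_on S" "r \<in> I" "0 < r" "p \<in> I" "0 < p" for h r p m
    by (rule circle_coeff_holomorphic[of _ S]) (use that S(1) seg in \<open>auto intro!: holomorphic_intros\<close>)
  have vanish: "circle_coeff (\<lambda>z. z * h z) r m = 0"
    if "h holomorphic_on S" "r \<in> I" "0 < r" "0 \<in> I" "m \<le> 0" for h r m
  proof -
    have "0 \<in> S" using that by (simp add: S_def)
    then obtain e where e: "e > 0" "ball 0 e \<subseteq> S" using S(1) openE by blast
    have *: "circle_coeff (\<lambda>z. z * h z) (min r (e/2)) m = 0"
      by (rule circle_coeff_disc[of _ e]) (use that e in \<open>auto intro: holomorphic_on_subset\<close>)
    \<comment> \<open>This radius lies in the small disk about 0 and, being between 0 and
      \<open>r\<close>, in \<open>I\<close>; the vanishing there can then be scaled to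
      \<open>r\<close>.\<close>
    have "min r (e/2) \<in> I"
      using that e I mem_is_interval_1_I[of I 0 r "min r (e/2)"] by auto
    from scale[OF that(1-3) this, of m] e(1) that(3) show ?thesis
      unfolding * by simp
  qed
  obtain p where p: "p \<in> I" "0 < p" using True by auto
  define G where "G z = z * cnj (dzbar u z)" for z
  define \<alpha> where "\<alpha> = circle_coeff (\<lambda>z. z * dz u z) p n / complex_of_real p powi n"
  \<comment> \<open>Conjugation turns frequency \<open>- n\<close> of the holomorphic
    \<open>G\<close> into frequency \<open>n\<close> of \<open>cnj z * dzbar u z\<close>.\<close>
  define \<beta> where "\<beta> = cnj (circle_coeff G p (- n)) / complex_of_real p powi (- n)"
  have \<alpha>: "circle_coeff (\<lambda>z. z * dz u z) r n = \<alpha> * complex_of_real r powi n" if "r \<in> I" "0 < r" for r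
    using scale[OF hol(1) that p] that p by (simp add: \<alpha>_def field_simps)
  have \<beta>: "circle_coeff (\<lambda>z. cnj z * dzbar u z) r n = \<beta> * complex_of_real r powi (- n)" if "r \<in> I" "0 < r" for r
  proof -
    have "circle_coeff (\<lambda>z. cnj z * dzbar u z) r n = cnj (circle_coeff G r (- n))"
      using circle_coeff_cnj[of G r n] by (simp add: G_def)
    also have "circle_coeff G r (- n) = circle_coeff G p (- n) / complex_of_real p powi (- n) * complex_of_real r powi (- n)"
      using scale[OF hol(2) that p, of "- n"] that p by (simp add: G_def[symmetric] field_simps)
    finally show ?thesis by (simp add: \<beta>_def)
  qed
  show ?thesis
  proof (rule that[of \<alpha> \<beta>])
    fix r assume r: "r \<in> I" "0 < r"
    show "circle_coeff (\<lambda>z. z * dz u z) r n = \<alpha> * complex_of_real r powi n" using \<alpha> r .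
    show "of_int n * circle_coeff u r n = \<alpha> * complex_of_real r powi n - \<beta> * complex_of_real r powi (- n)"
      using circle_coeff_tangential[of r u n] cont_r[OF r(1)] diff r \<alpha>[OF r] \<beta>[OF r] by simp
    show "complex_of_real r * circle_coeff (\<lambda>z. frechet_derivative u (at z) (sgn z)) r n
        = \<alpha> * complex_of_real r powi n + \<beta> * complex_of_real r powi (- n)"
      using circle_coeff_radial[of r u n] cont_r[OF r(1)] diff r \<alpha>[OF r] \<beta>[OF r] by simp
  next
    assume "0 \<in> I" "n \<le> 0"
    then show "\<alpha> = 0" using vanish[OF hol(1) p] by (simp add: \<alpha>_def)
  next
    assume "0 \<in> I" "0 \<le> n"
    then show "\<beta> = 0" using vanish[OF hol(2) p, of "- n"] by (simp add: \<beta>_def G_def[abs_def])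
  qed
qed

text \<open>The sign of \<open>n\<close> only exchanges the roles of \<alpha> and \<beta>: in both
  cases \<open>A\<close> belongs to the growing power and \<open>B\<close> to the one singular at
  the origin. One interface analysis thus serves both signs. The division by \<open>n\<close>
  excludes frequency 0.\<close>

lemma harmonic_circle_modes:
  assumes u: "harmonic_on u {z. norm z \<in> I}" and I: "is_interval I"
    and m: "0 < m" "n = int m \<or> n = - int m"
  obtains A B :: complex where
    "\<And>r. r \<in> I \<Longrightarrow> 0 < r \<Longrightarrow> circle_coeff u r n = A * complex_of_real r ^ m + B / complex_of_real r ^ m"
    "\<And>r. r \<in> I \<Longrightarrow> 0 < r \<Longrightarrow>
      complex_of_real r * circle_coeff (\<lambda>z. frechet_derivative u (at z) (sgn z)) r n
        = of_nat m * (A * complex_of_real r ^ m - B / complex_of_real r ^ m)"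
    "0 \<in> I \<Longrightarrow> B = 0"
proof -
  obtain \<alpha> \<beta> where
    "\<And>r. r \<in> I \<Longrightarrow> 0 < r \<Longrightarrow> circle_coeff (\<lambda>z. z * dz u z) r n = \<alpha> * complex_of_real r powi n"
    and *:
    "\<And>r. r \<in> I \<Longrightarrow> 0 < r \<Longrightarrow> of_int n * circle_coeff u r n
        = \<alpha> * complex_of_real r powi n - \<beta> * complex_of_real r powi (- n)"
    "\<And>r. r \<in> I \<Longrightarrow> 0 < r \<Longrightarrow> complex_of_real r * circle_coeff (\<lambda>z. frechet_derivative u (at z) (sgn z)) r n
        = \<alpha> * complex_of_real r powi n + \<beta> * complex_of_real r powi (- n)"
    "0 \<in> I \<Longrightarrow> n \<le> 0 \<Longrightarrow> \<alpha> = 0"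
    "0 \<in> I \<Longrightarrow> 0 \<le> n \<Longrightarrow> \<beta> = 0"
    by (rule harmonic_circle_coeffs[OF u I, of n]) (rule that; simp)
  have solve: "c = a / k * X + (- b / k) / X" if "k * c = a * X - b / X" "k \<noteq> 0" for a b c k X :: complex
  proof -
    have "c = (a * X - b / X) / k" unfolding that(1)[symmetric] using that(2) by simp
    then show ?thesis by (simp add: diff_divide_distrib mult.commute)
  qed
  have expand: "a * X + b / X = k * (a / k * X - (- b / k) / X)" if "k \<noteq> 0" for a b k X :: complex
    using that by (simp add: ring_distribs)
  have m0: "complex_of_nat m \<noteq> 0" using m(1) by simp
  from m(2) show ?thesis
  proof
    assume n: "n = int m"
    show ?thesis
    proof (rule that[of "\<alpha> / of_nat m" "- \<beta> / of_nat m"])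
      fix r assume r: "r \<in> I" "0 < r"
      show "circle_coeff u r n = \<alpha> / of_nat m * complex_of_real r ^ m + (- \<beta> / of_nat m) / complex_of_real r ^ m"
        using *(1)[OF r] by (intro solve m0) (simp add: n power_int_minus divide_inverse)
      show "complex_of_real r * circle_coeff (\<lambda>z. frechet_derivative u (at z) (sgn z)) r n
        = of_nat m * (\<alpha> / of_nat m * complex_of_real r ^ m - (- \<beta> / of_nat m) / complex_of_real r ^ m)"
        unfolding expand[OF m0, symmetric] using *(2)[OF r] by (simp add: n power_int_minus divide_inverse)
    qed (use *(4) n in auto)
  next
    assume n: "n = - int m"
    show ?thesis
    proof (rule that[of "\<beta> / of_nat m" "- \<alpha> / of_nat m"])
      fix r assume r: "r \<in> I" "0 < r"
      have "- (of_nat m * circle_coeff u r n) = \<alpha> / complex_of_real r ^ m - \<beta> * complex_of_real r ^ m"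
        using *(1)[OF r] by (simp add: n power_int_minus divide_inverse)
      then have "of_nat m * circle_coeff u r n = \<beta> * complex_of_real r ^ m - \<alpha> / complex_of_real r ^ m"
        by (metis minus_diff_eq minus_minus)
      then show "circle_coeff u r n = \<beta> / of_nat m * complex_of_real r ^ m + (- \<alpha> / of_nat m) / complex_of_real r ^ m"
        by (rule solve[OF _ m0])
      show "complex_of_real r * circle_coeff (\<lambda>z. frechet_derivative u (at z) (sgn z)) r n
        = of_nat m * (\<beta> / of_nat m * complex_of_real r ^ m - (- \<alpha> / of_nat m) / complex_of_real r ^ m)"
        unfolding expand[OF m0, symmetric] using *(2)[OF r] by (simp add: n power_int_minus divide_inverse add.commute)
    qed (use *(3) n in auto)
  qed
qed

section \<open>Differences of harmonic functions, and passage to the limit at an interface\<close>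

lemma partial_cong_open:
  assumes "open S" "x \<in> S" "\<And>y. y \<in> S \<Longrightarrow> f y = g y"
  shows "partial b f x = partial b g x"
proof -
  have "(f has_derivative D) (at x) \<longleftrightarrow> (g has_derivative D) (at x)" for D
    using has_derivative_transform_within_open[OF _ assms(1,2), of f D UNIV g]
      has_derivative_transform_within_open[OF _ assms(1,2), of g D UNIV f] assms(3) by auto
  then show ?thesis by (simp add: partial_def frechet_derivative_def)
qed

lemma partial_scaleR:
  assumes "f differentiable (at x)"
  shows "partial b (\<lambda>y. c *\<^sub>R f y) x = c *\<^sub>R partial b f x"
proof -
  have "(f has_derivative frechet_derivative f (at x)) (at x)"
    using assms frechet_derivative_works by blast
  then have "((\<lambda>y. c *\<^sub>R f y) has_derivative (\<lambda>h. c *\<^sub>R frechet_derivative f (at x) h)) (at x)"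
    by (rule has_derivative_scaleR_right)
  then show ?thesis by (simp add: partial_eqI partial_def[of b f])
qed

lemma partial_diff:
  assumes "f differentiable (at x)" "g differentiable (at x)"
  shows "partial b (\<lambda>y. f y - g y) x = partial b f x - partial b g x"
proof -
  have "(f has_derivative frechet_derivative f (at x)) (at x)"
    "(g has_derivative frechet_derivative g (at x)) (at x)"
    using assms frechet_derivative_works by blast+
  then have "((\<lambda>y. f y - g y) has_derivative
      (\<lambda>h. frechet_derivative f (at x) h - frechet_derivative g (at x) h)) (at x)"
    by (rule has_derivative_diff)
  then show ?thesis by (simp add: partial_eqI partial_def[of b f] partial_def[of b g])
qed

lemma harmonic_on_diff:
  assumes "harmonic_on u S" "harmonic_on v S"
  shows "harmonic_on (\<lambda>z. u z - v z) S"
proof -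
  have S: "open S" and tu: "twice_cont_diff_on u S" and tv: "twice_cont_diff_on v S"
    using assms by (auto simp: harmonic_on_def)
  have d: "u differentiable (at x)" "v differentiable (at x)"
    "b \<in> Basis \<Longrightarrow> partial b u differentiable (at x)"
    "b \<in> Basis \<Longrightarrow> partial b v differentiable (at x)" if "x \<in> S" for x b
    using tu tv that by (auto simp: twice_cont_diff_on_def)
  have p: "partial b (\<lambda>z. u z - v z) x = partial b u x - partial b v x" if "x \<in> S" for b x
    using partial_diff d that by blast
  have pp: "partial c (partial b (\<lambda>z. u z - v z)) x = partial c (partial b u) x - partial c (partial b v) x"
    if "x \<in> S" "b \<in> Basis" for b c x
    using partial_cong_open[OF S that(1), of "partial b (\<lambda>z. u z - v z)" "\<lambda>z. partial b u z - partial b v z" c] p partial_diff d that by simp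
  have dp: "partial b (\<lambda>z. u z - v z) differentiable (at x)" if "x \<in> S" "b \<in> Basis" for b x
  proof -
    have "((\<lambda>z. partial b u z - partial b v z) has_derivative
      frechet_derivative (\<lambda>z. partial b u z - partial b v z) (at x)) (at x)"
      using d(3,4)[OF that] differentiable_diff frechet_derivative_works by blast
    from has_derivative_transform_within_open[OF this S that(1)] p
    show ?thesis by (metis differentiableI)
  qed
  have cc: "continuous_on S (partial c (partial b (\<lambda>z. u z - v z)))" if "b \<in> Basis" "c \<in> Basis" for b c
  proof -
    have "continuous_on S (\<lambda>x. partial c (partial b u) x - partial c (partial b v) x)"
      using tu tv that by (intro continuous_intros) (auto simp: twice_cont_diff_on_def)
    then show ?thesis using pp that(1) by (simp cong: continuous_on_cong)
  qed
  have "(\<Sum>b\<in>Basis. partial b (partial b (\<lambda>z. u z - v z)) x) = 0" if "x \<in> S" for x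
    using that assms by (simp add: pp sum_subtractf harmonic_on_def)
  then show ?thesis
    using S d dp cc by (auto simp: harmonic_on_def twice_cont_diff_on_def)
qed

text \<open>Off \<open>K\<close> the values of \<open>F\<close> near \<open>x\<close> are within
  \<open>e / 2\<close> of the limit at \<open>x\<close>. The extension at a nearby point of
  \<open>K\<close> is itself a limit of such values, because the complement of \<open>K\<close> is
  dense, so it is within \<open>e / 2\<close> too. Pointwise limits therefore already give joint
  continuity, as is needed for the flux.\<close>

lemma continuous_on_limit_extension:
  fixes F :: "'a::{metric_space,perfect_space} \<Rightarrow> 'b::metric_space"
  assumes K: "closed K" "interior K = {}" and U: "open U"
    and F: "continuous_on (U - K) F"
    and lim: "\<And>x. x \<in> U \<inter> K \<Longrightarrow> \<exists>L. (F \<longlongrightarrow> L) (at x within - K)"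
  obtains G where "continuous_on U G" "\<And>x. x \<notin> K \<Longrightarrow> G x = F x"
proof -
  define G where "G x = (if x \<in> K then (SOME L. (F \<longlongrightarrow> L) (at x within - K)) else F x)" for x
  have nontriv: "at x within - K \<noteq> bot" for x
  proof -
    have "x \<in> closure (- K)" using K(2) by (simp add: closure_complement)
    moreover have "x islimpt - K" if "x \<in> - K"
      using that K(1) by (simp add: interior_limit_point open_Compl interior_open)
    ultimately show ?thesis by (auto simp: closure_def trivial_limit_within)
  qed
  have G: "(F \<longlongrightarrow> G x) (at x within - K)" if "x \<in> U" for x
  proof (cases "x \<in> K")
    case True
    then show ?thesis using someI_ex[OF lim[of x]] that by (simp add: G_def)
  next
    case False
    then have "isCont F x"
      using F that U K(1) by (simp add: continuous_on_eq_continuous_at open_Diff)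
    then show ?thesis
      using False by (auto simp: G_def isCont_def intro: tendsto_within_subset)
  qed
  have "\<exists>d>0. \<forall>y\<in>U. dist y x < d \<longrightarrow> dist (G y) (G x) < e" if "x \<in> U" "0 < e" for x e
  proof -
    have "\<forall>\<^sub>F y in at x within - K. dist (F y) (G x) < e / 2"
      using tendstoD[OF G[OF that(1)], of "e / 2"] that(2) by simp
    then obtain d where d: "0 < d" "\<And>y. y \<in> - K \<Longrightarrow> y \<noteq> x \<Longrightarrow> dist y x < d \<Longrightarrow> dist (F y) (G x) < e / 2"
      by (auto simp: eventually_at)
    have "dist (G y) (G x) < e" if y: "y \<in> U" "dist y x < d" for y
    proof (cases "y = x")
      case False
      have "open (ball x d - {x})" "y \<in> ball x d - {x}"
        using False y(2) by (auto simp: dist_commute open_Diff)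
      then have "\<forall>\<^sub>F z in at y within - K. z \<in> ball x d - {x}"
        by (rule eventually_at_in_open'[THEN filter_leD[OF at_le[OF subset_UNIV]]])
      moreover have "\<forall>\<^sub>F z in at y within - K. z \<in> - K"
        by (simp add: eventually_at_filter)
      ultimately have "\<forall>\<^sub>F z in at y within - K. dist (F z) (G x) \<le> e / 2"
        by eventually_elim (use d(2) in \<open>force simp: dist_commute\<close>)
      moreover have "((\<lambda>z. dist (F z) (G x)) \<longlongrightarrow> dist (G y) (G x)) (at y within - K)"
        by (intro tendsto_intros G y)
      ultimately have "dist (G y) (G x) \<le> e / 2"
        using tendsto_upperbound nontriv by blast
      then show ?thesis using \<open>0 < e\<close> by linarith
    qed (use \<open>0 < e\<close> in simp)
    with d(1) show ?thesis by blast
  qed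
  then have "continuous_on U G" by (simp add: continuous_on_iff)
  with that show ?thesis by (simp add: G_def)
qed

lemma circle_coeff_continuous:
  assumes "continuous_on {z. norm z \<in> I} G" "I \<subseteq> {0..}"
  shows "continuous_on I (\<lambda>r. circle_coeff G r n)"
proof -
  have "continuous_on (I \<times> cbox 0 (2*pi)) (\<lambda>(r, t). G (rcis r t) * cis (- (of_int n * t)))"
    unfolding split_beta
    by (intro continuous_intros continuous_on_compose2[OF assms(1)]) (use assms(2) in auto)
  from integral_continuous_on_param[OF this] show ?thesis
    by (simp add: circle_coeff_def)
qed

text \<open>\<open>f\<close> and \<open>g\<close> are explicit formulas valid on either side of an
  interface; both take at \<rho> the value of the continuous \<open>h\<close>, although
  \<open>h\<close> need not be given by a formula there.\<close>

lemma continuous_glue: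
  fixes h f g :: "real \<Rightarrow> 'a::t2_space"
  assumes "c < \<rho>" "\<rho> < d" "continuous_on {c<..<d} h" "isCont f \<rho>" "isCont g \<rho>"
    and "\<And>r. c < r \<Longrightarrow> r < \<rho> \<Longrightarrow> h r = f r" "\<And>r. \<rho> < r \<Longrightarrow> r < d \<Longrightarrow> h r = g r"
  shows "f \<rho> = g \<rho>"
proof -
  have h: "(h \<longlongrightarrow> h \<rho>) (at_left \<rho>)" "(h \<longlongrightarrow> h \<rho>) (at_right \<rho>)"
    using assms(1-3) by (auto simp: continuous_on_eq_continuous_at isCont_def filterlim_at_split)
  have "(f \<longlongrightarrow> f \<rho>) (at_left \<rho>)" "(g \<longlongrightarrow> g \<rho>) (at_right \<rho>)"
    using assms(4,5) by (auto simp: isCont_def filterlim_at_split)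
  moreover have "\<forall>\<^sub>F r in at_left \<rho>. f r = h r"
    using eventually_at_left_field assms(1,6) by force
  moreover have "\<forall>\<^sub>F r in at_right \<rho>. g r = h r"
    using eventually_at_right_field assms(2,7) by force
  ultimately have "(h \<longlongrightarrow> f \<rho>) (at_left \<rho>)" "(h \<longlongrightarrow> g \<rho>) (at_right \<rho>)"
    using tendsto_cong by blast+
  then show ?thesis
    using h tendsto_unique[OF trivial_limit_at_left_real] tendsto_unique[OF trivial_limit_at_right_real]
    by metis
qed

section \<open>A single Fourier mode in a layered disk\<close>

text \<open>In the layer \<open>k\<close> the mode is \<open>A k * \<rho> ^ m + B k / \<rho> ^ m\<close>; the circle between the layers \<open>k\<close> and
  \<open>Suc k\<close> has radius \<open>r (Suc k)\<close>, and \<open>B N = 0\<close> says that the mode is regular at the origin.\<close>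

definition transmission_system ::
    "nat \<Rightarrow> (nat \<Rightarrow> real) \<Rightarrow> (nat \<Rightarrow> real) \<Rightarrow> nat \<Rightarrow> (nat \<Rightarrow> complex) \<Rightarrow> (nat \<Rightarrow> complex) \<Rightarrow> bool" where
  "transmission_system N r s m A B \<longleftrightarrow> B N = 0 \<and>
     (\<forall>k<N. A k * of_real (r (Suc k)) ^ m + B k / of_real (r (Suc k)) ^ m
          = A (Suc k) * of_real (r (Suc k)) ^ m + B (Suc k) / of_real (r (Suc k)) ^ m \<and>
        of_real (s k) * (A k * of_real (r (Suc k)) ^ m - B k / of_real (r (Suc k)) ^ m)
          = of_real (s (Suc k)) * (A (Suc k) * of_real (r (Suc k)) ^ m - B (Suc k) / of_real (r (Suc k)) ^ m))"

lemma transmission_systemD: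
  assumes "transmission_system N r s m A B" "k < N"
  shows "A k * of_real (r (Suc k)) ^ m + B k / of_real (r (Suc k)) ^ m
      = A (Suc k) * of_real (r (Suc k)) ^ m + B (Suc k) / of_real (r (Suc k)) ^ m"
    "of_real (s k) * (A k * of_real (r (Suc k)) ^ m - B k / of_real (r (Suc k)) ^ m)
      = of_real (s (Suc k)) * (A (Suc k) * of_real (r (Suc k)) ^ m - B (Suc k) / of_real (r (Suc k)) ^ m)"
  using assms by (auto simp: transmission_system_def)

text \<open>Multiplying the two interface conditions gives an energy identity, because
  \<open>Re ((x + y) * cnj (x - y)) = (norm x)\<^sup>2 - (norm y)\<^sup>2\<close>.\<close>

lemma transmission_norm_less:
  fixes a b a' b' :: complex
  assumes "a' + b' = a + b" "of_real s' * (a' - b') = of_real s * (a - b)"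
    and "0 < s" "0 < s'" "norm b < norm a"
  shows "norm b' < norm a'"
proof -
  have energy: "(norm x)\<^sup>2 - (norm y)\<^sup>2 = Re ((x + y) * cnj (x - y))" for x y :: complex
    by (simp only: cmod_power2) (simp add: algebra_simps power2_eq_square)
  have "s' * ((norm a')\<^sup>2 - (norm b')\<^sup>2) = Re ((a' + b') * cnj (of_real s' * (a' - b')))"
    unfolding energy by (simp add: algebra_simps)
  also have "\<dots> = s * ((norm a)\<^sup>2 - (norm b)\<^sup>2)"
    unfolding assms(1,2) energy by (simp add: algebra_simps)
  finally have "s' * ((norm a')\<^sup>2 - (norm b')\<^sup>2) = s * ((norm a)\<^sup>2 - (norm b)\<^sup>2)" .
  moreover have "(norm b)\<^sup>2 < (norm a)\<^sup>2" using assms(5) by (simp add: power_strict_mono)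
  ultimately have "(norm b')\<^sup>2 < (norm a')\<^sup>2"
    using assms(3,4) by (smt (verit) mult_pos_pos zero_less_mult_pos)
  then show ?thesis by (rule power2_less_imp_less) simp
qed

lemma concentric_disk_props:
  assumes "concentric_disk N r s"
  shows "k < N \<Longrightarrow> 0 < r (Suc k)" "Suc k < N \<Longrightarrow> r (Suc (Suc k)) < r (Suc k)"
    "k \<le> N \<Longrightarrow> 0 < s k" "k < N \<Longrightarrow> s (Suc k) \<noteq> s k"
proof -
  have dec: "r (Suc k) < r k" if "1 \<le> k" "k < N" for k
    using assms that by (simp add: concentric_disk_def)
  have pos: "0 < r j" if "j \<le> N" "1 \<le> j" for j
    using that
  proof (induction j rule: inc_induct)
    case base
    then show ?case using assms by (simp add: concentric_disk_def)
  next
    case (step j)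
    then show ?case using dec[of j] by simp
  qed
  then show "k < N \<Longrightarrow> 0 < r (Suc k)" by simp
  show "k < N \<Longrightarrow> s (Suc k) \<noteq> s k"
    using assms by (auto simp: concentric_disk_def dest: bspec[of _ _ "Suc k"])
qed (use assms in \<open>auto simp: concentric_disk_def\<close>)

text \<open>Dominance of the growing part starts at the core, where \<open>B N = 0\<close>. At an
  interface the energy identity hands it to the next layer out; inside a layer it persists because a
  larger radius enlarges the growing term and shrinks the other.\<close>

lemma transmission_system_bound:
  assumes disk: "concentric_disk N r s" and sys: "transmission_system N r s m A B"
    and m: "0 < m" and nz: "A N \<noteq> 0" and k: "k < N"
  shows "A k \<noteq> 0" "norm (B k) < norm (A k) * r (Suc k) ^ (2 * m)"
proof -
  have le: "norm (B k) < norm (A k) * r (Suc k) ^ (2 * m)"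
    if k: "k < N" and b: "norm (B (Suc k) / of_real (r (Suc k)) ^ m) < norm (A (Suc k) * of_real (r (Suc k)) ^ m)" for k
  proof -
    have pos: "0 < r (Suc k)" "0 < s k" "0 < s (Suc k)"
      using concentric_disk_props[OF disk] k by auto
    have "norm (B k / of_real (r (Suc k)) ^ m) < norm (A k * of_real (r (Suc k)) ^ m)"
      by (rule transmission_norm_less[OF _ _ pos(3,2) b])
        (use sys k in \<open>auto simp: transmission_system_def add.commute\<close>)
    then have "norm (B k) / r (Suc k) ^ m < norm (A k) * r (Suc k) ^ m"
      using pos by (simp add: norm_divide norm_mult norm_power)
    then show ?thesis
      using pos by (simp add: pos_divide_less_eq mult_2 power_add mult.assoc)
  qed
  have "norm (B k / of_real (r k) ^ m) < norm (A k * of_real (r k) ^ m)" if "1 \<le> k" "k \<le> N" for k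
    using that(2,1)
  proof (induction k rule: inc_induct)
    case base
    have "0 < r N" using concentric_disk_props(1)[OF disk, of "N - 1"] base by simp
    then show ?case using nz sys by (simp add: transmission_system_def)
  next
    case (step n)
    then have "norm (B n) < norm (A n) * r (Suc n) ^ (2 * m)" using le[of n] by simp
    moreover have r: "0 < r (Suc n)" "r (Suc n) < r n"
      using concentric_disk_props(1)[OF disk, of n] concentric_disk_props(2)[OF disk, of "n - 1"] step by auto
    then have "r (Suc n) ^ (2 * m) \<le> r n ^ (2 * m)"
      by (intro power_mono) auto
    then have "norm (A n) * r (Suc n) ^ (2 * m) \<le> norm (A n) * r n ^ (2 * m)"
      by (intro mult_left_mono) auto
    ultimately have "norm (B n) < norm (A n) * r n ^ (2 * m)" by linarith
    then show ?case
      using r by (simp add: norm_divide norm_mult norm_power pos_divide_less_eq mult_2 power_add mult.assoc)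
  qed
  with le k show "norm (B k) < norm (A k) * r (Suc k) ^ (2 * m)" by simp
  then show "A k \<noteq> 0" by (auto simp: not_less)
qed

text \<open>With \<open>X\<close> the m-th power of the radius, the sum and difference of the two
  conditions isolate \<open>A\<close> and \<open>B\<close>: trace and flux on one side of an
  interface determine the pair there.\<close>

lemma transmission_system_unique:
  fixes X :: complex
  assumes "A * X + B / X = C * X + D / X" "s * (A * X - B / X) = s * (C * X - D / X)" "s \<noteq> 0" "X \<noteq> 0"
  shows "A = C" "B = D"
proof -
  have 1: "A * X - B / X = C * X - D / X" using assms(2,3) by simp
  have "2 * (A * X) = (A * X + B / X) + (A * X - B / X)" by simp
  also have "\<dots> = 2 * (C * X)" unfolding 1 assms(1) by simp
  finally show "A = C" using assms(4) by simp
  with assms(1,4) show "B = D" by simp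
qed

lemma transmission_system_inner_zero:
  assumes disk: "concentric_disk N r s" and sys: "transmission_system N r s m A B"
    and z: "A N = 0"
  shows "A 0 = 0" "B 0 = 0"
proof -
  have "A k = 0 \<and> B k = 0" if "k \<le> N" for k
    using that
  proof (induction k rule: inc_induct)
    case base
    then show ?case using sys z by (simp add: transmission_system_def)
  next
    case (step k)
    define X where "X = complex_of_real (r (Suc k)) ^ m"
    have "A k * X + B k / X = 0 * X + 0 / X"
      "complex_of_real (s k) * (A k * X - B k / X) = complex_of_real (s k) * (0 * X - 0 / X)"
      using sys step unfolding transmission_system_def X_def by auto
    moreover have "complex_of_real (s k) \<noteq> 0" "X \<noteq> 0"
      using concentric_disk_props[OF disk, of k] step by (auto simp: X_def)
    ultimately show ?case using transmission_system_unique by blast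
  qed
  from this[of 0] show "A 0 = 0" "B 0 = 0" by auto
qed

text \<open>Uniqueness for one mode: a nonzero core coefficient would force
  \<open>A 0 \<noteq> 0\<close> by the energy bound, and a zero core propagates outward as
  zero.\<close>

lemma transmission_system_zero:
  assumes disk: "concentric_disk N r s" and sys: "transmission_system N r s m A B"
    and m: "0 < m" and z: "A 0 = 0"
  shows "B 0 = 0"
proof -
  have "0 < N" using disk by (simp add: concentric_disk_def)
  then have "A N = 0" using transmission_system_bound(1)[OF disk sys m, of 0] z by blast
  then show ?thesis by (rule transmission_system_inner_zero[OF disk sys])
qed

lemma power_ratio_tendsto_0:
  fixes p q :: real
  assumes "0 < p" "p < q"
  shows "(\<lambda>m. (p / q) ^ (2 * m)) \<longlonglongrightarrow> 0"
proof -
  have "(p / q)\<^sup>2 < 1" using assms by (simp add: power_less_one_iff)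
  then show ?thesis
    unfolding power_mult by (intro LIMSEQ_power_zero) simp
qed

text \<open>The limit is the reflection coefficient of the single interface of radius
  \<open>r (Suc k)\<close>. The inner layers enter only through \<open>t m\<close>, which is 0 for
  the core and otherwise at most the power \<open>2 * m\<close> of a quotient of consecutive radii
  that is below 1.\<close>

lemma transmission_system_asymptotics:
  assumes disk: "concentric_disk N r s"
    and sys: "\<And>m. 0 < m \<Longrightarrow> transmission_system N r s m (A m) (B m)"
    and nz: "\<forall>\<^sub>F m in sequentially. A m N \<noteq> 0" and k: "k < N"
  shows "(\<lambda>m. B m k / A m k / of_real (r (Suc k)) ^ (2 * m))
    \<longlonglongrightarrow> of_real ((s k - s (Suc k)) / (s k + s (Suc k)))"
proof -
  define t where "t m = B m (Suc k) / A m (Suc k) / of_real (r (Suc k)) ^ (2 * m)" for m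
  have pos: "0 < r (Suc k)" "0 < s k" "0 < s (Suc k)"
    using concentric_disk_props[OF disk] k by auto
  have nz': "\<forall>\<^sub>F m in sequentially. 0 < m \<and> A m N \<noteq> 0"
    using nz eventually_gt_at_top[of 0] by eventually_elim auto
  have t0: "t \<longlonglongrightarrow> 0"
  proof (cases "Suc k = N")
    case True
    have "\<forall>\<^sub>F m in sequentially. t m = 0"
      using eventually_gt_at_top[of 0] by eventually_elim (use sys True in \<open>auto simp: t_def transmission_system_def\<close>)
    then show ?thesis by (rule tendsto_eventually)
  next
    case False
    then have k': "Suc k < N" using k by simp
    have r: "0 < r (Suc (Suc k))" "r (Suc (Suc k)) < r (Suc k)"
      using concentric_disk_props[OF disk] k' by auto
    have "\<forall>\<^sub>F m in sequentially. norm (t m) \<le> (r (Suc (Suc k)) / r (Suc k)) ^ (2 * m)"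
      using nz'
    proof eventually_elim
      case (elim m)
      then have "A m (Suc k) \<noteq> 0" "norm (B m (Suc k)) < norm (A m (Suc k)) * r (Suc (Suc k)) ^ (2 * m)"
        using transmission_system_bound[OF disk sys[of m] _ _ k'] by auto
      then have "norm (B m (Suc k)) / norm (A m (Suc k)) \<le> r (Suc (Suc k)) ^ (2 * m)"
        by (simp add: pos_divide_le_eq mult.commute)
      then have "norm (B m (Suc k)) / norm (A m (Suc k)) / r (Suc k) ^ (2 * m)
          \<le> r (Suc (Suc k)) ^ (2 * m) / r (Suc k) ^ (2 * m)"
        by (rule divide_right_mono) (use pos in simp)
      then show ?case
        using pos by (simp only: t_def norm_divide norm_power power_divide norm_of_real abs_of_pos)
    qed
    then show ?thesis
      by (rule Lim_null_comparison) (rule power_ratio_tendsto_0[OF r])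
  qed
  \<comment> \<open>Solving the two interface conditions for the outer pair gives its normalised
    ratio as a Moebius function \<open>g\<close> of the inner one, \<open>t m\<close>;
    \<open>g 0\<close> is the reflection coefficient.\<close>
  define g where "g z = (of_real (s k - s (Suc k)) + of_real (s k + s (Suc k)) * z)
    / (of_real (s k + s (Suc k)) + of_real (s k - s (Suc k)) * z)" for z :: complex
  have "(\<lambda>m. g (t m)) \<longlonglongrightarrow> (of_real (s k - s (Suc k)) + of_real (s k + s (Suc k)) * 0)
    / (of_real (s k + s (Suc k)) + of_real (s k - s (Suc k)) * 0)"
    unfolding g_def by (intro tendsto_intros t0) (use pos in \<open>simp flip: of_real_add\<close>)
  moreover have "\<forall>\<^sub>F m in sequentially. g (t m) = B m k / A m k / of_real (r (Suc k)) ^ (2 * m)"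
    using nz'
  proof eventually_elim
    case (elim m)
    define X where "X = complex_of_real (r (Suc k)) ^ m"
    have X: "X \<noteq> 0" using pos by (simp add: X_def)
    have X2: "complex_of_real (r (Suc k)) ^ (2 * m) = X * X" by (simp add: X_def mult_2 power_add)
    define a b a' b' where "a = A m (Suc k) * X" and "b = B m (Suc k) / X"
      and "a' = A m k * X" and "b' = B m k / X"
    define \<sigma> \<sigma>' where "\<sigma> = complex_of_real (s (Suc k))" and "\<sigma>' = complex_of_real (s k)"
    have \<sigma>: "\<sigma>' \<noteq> 0" using pos by (simp add: \<sigma>'_def)
    have e: "a' + b' = a + b" "\<sigma>' * (a' - b') = \<sigma> * (a - b)"
      using sys[of m] elim k
      by (auto simp: transmission_system_def a_def b_def a'_def b'_def \<sigma>_def \<sigma>'_def X_def)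
    have nza: "A m k \<noteq> 0" using transmission_system_bound(1)[OF disk sys[of m] _ _ k] elim by auto
    have nzs: "A m (Suc k) \<noteq> 0"
    proof (cases "Suc k = N")
      case False
      then show ?thesis using transmission_system_bound(1)[OF disk sys[of m], of "Suc k"] elim k by auto
    qed (use elim in simp)
    have "2 * \<sigma>' * a' = \<sigma>' * (a' + b') + \<sigma>' * (a' - b')" by (simp add: algebra_simps)
    also have "\<dots> = (\<sigma>' + \<sigma>) * a + (\<sigma>' - \<sigma>) * b" unfolding e by (simp add: algebra_simps)
    finally have a': "2 * \<sigma>' * a' = (\<sigma>' + \<sigma>) * a + (\<sigma>' - \<sigma>) * b" .
    have "2 * \<sigma>' * b' = \<sigma>' * (a' + b') - \<sigma>' * (a' - b')" by (simp add: algebra_simps)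
    also have "\<dots> = (\<sigma>' - \<sigma>) * a + (\<sigma>' + \<sigma>) * b" unfolding e by (simp add: algebra_simps)
    finally have b': "2 * \<sigma>' * b' = (\<sigma>' - \<sigma>) * a + (\<sigma>' + \<sigma>) * b" .
    have t: "t m = b / a"
      using X nzs by (simp only: t_def a_def b_def X2) (simp add: field_simps)
    have a: "a \<noteq> 0" using X nzs by (simp add: a_def)
    have at: "b = a * t m" using t a by simp
    have "g (t m) = ((\<sigma>' - \<sigma>) + (\<sigma>' + \<sigma>) * t m) / ((\<sigma>' + \<sigma>) + (\<sigma>' - \<sigma>) * t m)"
      by (simp add: g_def \<sigma>_def \<sigma>'_def)
    also have "\<dots> = (a * ((\<sigma>' - \<sigma>) + (\<sigma>' + \<sigma>) * t m)) / (a * ((\<sigma>' + \<sigma>) + (\<sigma>' - \<sigma>) * t m))"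
      using a by simp
    also have "a * ((\<sigma>' - \<sigma>) + (\<sigma>' + \<sigma>) * t m) = 2 * \<sigma>' * b'"
      unfolding b' at by (simp add: algebra_simps)
    also have "a * ((\<sigma>' + \<sigma>) + (\<sigma>' - \<sigma>) * t m) = 2 * \<sigma>' * a'"
      unfolding a' at by (simp add: algebra_simps)
    also have "(2 * \<sigma>' * b') / (2 * \<sigma>' * a') = b' / a'" using \<sigma> by simp
    also have "\<dots> = B m k / A m k / of_real (r (Suc k)) ^ (2 * m)"
      using X nza by (simp only: a'_def b'_def X2) (simp add: field_simps)
    finally show ?case .
  qed
  ultimately show ?thesis
    by (simp add: tendsto_cong)
qed

text \<open>The two normalisations differ by a factor that tends to 0 or blows up unless the radii
  agree, so a nonzero limit fixes the radius. In the application the limits are nonzero since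
  adjacent conductivities differ.\<close>

lemma transmission_rate_unique:
  fixes q :: "nat \<Rightarrow> complex"
  assumes "0 < p1" "0 < p2" "l1 \<noteq> 0" "l2 \<noteq> 0"
    and "(\<lambda>m. q m / of_real p1 ^ (2 * m)) \<longlonglongrightarrow> l1"
    and "(\<lambda>m. q m / of_real p2 ^ (2 * m)) \<longlonglongrightarrow> l2"
  shows "p1 = p2" "l1 = l2"
proof -
  have less: False if "0 < p" "p < p'" "(\<lambda>m. q m / of_real p ^ (2 * m)) \<longlonglongrightarrow> l"
    "(\<lambda>m. q m / of_real p' ^ (2 * m)) \<longlonglongrightarrow> l'" "l' \<noteq> 0" for p p' :: real and l l' :: complex
  proof -
    have "(\<lambda>m. q m / of_real p ^ (2 * m) * of_real ((p / p') ^ (2 * m))) \<longlonglongrightarrow> l * of_real 0"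
      by (intro tendsto_intros that(3) power_ratio_tendsto_0 that(1,2))
    moreover have "(\<lambda>m. q m / of_real p ^ (2 * m) * of_real ((p / p') ^ (2 * m)))
        = (\<lambda>m. q m / of_real p' ^ (2 * m))"
      using that(1) by (simp add: power_divide)
    ultimately show False using LIMSEQ_unique that(4,5) by fastforce
  qed
  show "p1 = p2"
    using less[OF assms(1) _ assms(5,6,4)] less[OF assms(2) _ assms(6,5,3)] by (meson linorder_neqE)
  with assms(5,6) show "l1 = l2" using LIMSEQ_unique by blast
qed

lemma transmission_identification:
  assumes disk1: "concentric_disk N r1 s1" and disk2: "concentric_disk N r2 s2"
    and sys1: "\<And>m. 0 < m \<Longrightarrow> transmission_system N r1 s1 m (A1 m) (B1 m)"
    and sys2: "\<And>m. 0 < m \<Longrightarrow> transmission_system N r2 s2 m (A2 m) (B2 m)"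
    and nz: "\<forall>\<^sub>F m in sequentially. A1 m 0 \<noteq> 0"
    and eq: "\<forall>\<^sub>F m in sequentially. A1 m 0 = A2 m 0 \<and> B1 m 0 = B2 m 0"
  shows "\<forall>k\<in>{1..N}. r1 k = r2 k \<and> s1 k = s2 k"
proof -
  \<comment> \<open>The asymptotics divide by inner coefficients, whereas the data concern the
    exterior. A vanishing core coefficient would propagate outward and make the exterior one
    vanish.\<close>
  have innermost: "\<forall>\<^sub>F m in sequentially. A m N \<noteq> 0"
    if "concentric_disk N r s" "\<And>m. 0 < m \<Longrightarrow> transmission_system N r s m (A m) (B m)"
      "\<forall>\<^sub>F m in sequentially. A m 0 \<noteq> 0" for r s A B
    using that(3) eventually_gt_at_top[of 0]
    by eventually_elim (use transmission_system_inner_zero[OF that(1) that(2)] in blast)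
  have nz2: "\<forall>\<^sub>F m in sequentially. A2 m 0 \<noteq> 0"
    using nz eq by eventually_elim auto
  have asym1: "(\<lambda>m. B1 m k / A1 m k / of_real (r1 (Suc k)) ^ (2 * m))
      \<longlonglongrightarrow> of_real ((s1 k - s1 (Suc k)) / (s1 k + s1 (Suc k)))" if "k < N" for k
    by (rule transmission_system_asymptotics[OF disk1 sys1 innermost[OF disk1 sys1 nz] that])
  have asym2: "(\<lambda>m. B2 m k / A2 m k / of_real (r2 (Suc k)) ^ (2 * m))
      \<longlonglongrightarrow> of_real ((s2 k - s2 (Suc k)) / (s2 k + s2 (Suc k)))" if "k < N" for k
    by (rule transmission_system_asymptotics[OF disk2 sys2 innermost[OF disk2 sys2 nz2] that])
  have "(\<forall>i\<in>{1..k}. r1 i = r2 i) \<and> (\<forall>i\<le>k. s1 i = s2 i) \<and>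
      (\<forall>\<^sub>F m in sequentially. A1 m k = A2 m k \<and> B1 m k = B2 m k)" if "k \<le> N" for k
    using that
  proof (induction k)
    case 0
    then show ?case
      using disk1 disk2 eq by (auto simp: concentric_disk_def)
  next
    case (Suc k)
    then have k: "k < N" and s: "s1 k = s2 k"
      and e: "\<forall>\<^sub>F m in sequentially. A1 m k = A2 m k \<and> B1 m k = B2 m k" by auto
    have pos: "0 < r1 (Suc k)" "0 < r2 (Suc k)" "0 < s1 k" "0 < s1 (Suc k)" "0 < s2 (Suc k)"
      "s1 (Suc k) \<noteq> s1 k" "s2 (Suc k) \<noteq> s1 k"
      using concentric_disk_props[OF disk1, of k] concentric_disk_props[OF disk1, of "Suc k"]
        concentric_disk_props[OF disk2, of k] concentric_disk_props[OF disk2, of "Suc k"] k s by auto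
    have "\<forall>\<^sub>F m in sequentially. B2 m k / A2 m k / complex_of_real (r2 (Suc k)) ^ (2 * m)
        = B1 m k / A1 m k / complex_of_real (r2 (Suc k)) ^ (2 * m)"
      using e by eventually_elim simp
    with asym2[OF k] have "(\<lambda>m. B1 m k / A1 m k / complex_of_real (r2 (Suc k)) ^ (2 * m))
        \<longlonglongrightarrow> of_real ((s2 k - s2 (Suc k)) / (s2 k + s2 (Suc k)))"
      by (simp add: tendsto_cong)
    note uniq = transmission_rate_unique[OF pos(1,2) _ _ asym1[OF k] this]
    have r: "r1 (Suc k) = r2 (Suc k)"
      by (rule uniq) (use pos s in \<open>simp_all flip: of_real_diff of_real_add of_real_divide\<close>)
    have "complex_of_real ((s1 k - s1 (Suc k)) / (s1 k + s1 (Suc k)))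
        = complex_of_real ((s2 k - s2 (Suc k)) / (s2 k + s2 (Suc k)))"
      by (rule uniq) (use pos s in \<open>simp_all flip: of_real_diff of_real_add of_real_divide\<close>)
    then have "(s1 k - s1 (Suc k)) / (s1 k + s1 (Suc k)) = (s1 k - s2 (Suc k)) / (s1 k + s2 (Suc k))"
      unfolding of_real_eq_iff s[symmetric] .
    \<comment> \<open>For fixed positive \<open>s\<close> the map sending x to (s - x) / (s + x) is
      injective on positive x.\<close>
    then have "s1 k * (s1 (Suc k) - s2 (Suc k)) = 0"
      using pos by (simp add: frac_eq_eq algebra_simps)
    then have s': "s1 (Suc k) = s2 (Suc k)" using pos by simp
    have "\<forall>\<^sub>F m in sequentially. A1 m (Suc k) = A2 m (Suc k) \<and> B1 m (Suc k) = B2 m (Suc k)"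
      using e eventually_gt_at_top[of 0]
    proof eventually_elim
      case (elim m)
      define X where "X = complex_of_real (r1 (Suc k)) ^ m"
      have "A1 m (Suc k) * X + B1 m (Suc k) / X = A2 m (Suc k) * X + B2 m (Suc k) / X"
        "of_real (s1 (Suc k)) * (A1 m (Suc k) * X - B1 m (Suc k) / X)
          = of_real (s1 (Suc k)) * (A2 m (Suc k) * X - B2 m (Suc k) / X)"
        using transmission_systemD[OF sys1 k, of m] transmission_systemD[OF sys2 k, of m] elim s r s'
        unfolding X_def by auto
      moreover have "complex_of_real (s1 (Suc k)) \<noteq> 0" "X \<noteq> 0" using pos by (auto simp: X_def)
      ultimately show ?case using transmission_system_unique by blast
    qed
    with Suc r s' show ?case by (auto simp: le_Suc_eq)
  qed
  from this[of N] show ?thesis by auto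
qed

section \<open>Solutions of the transmission problem\<close>

lemma harmonic_on_subset:
  assumes "harmonic_on u S" "open T" "T \<subseteq> S"
  shows "harmonic_on u T"
  using assms unfolding harmonic_on_def twice_cont_diff_on_def
  by (meson continuous_on_subset subsetD)

text \<open>The innermost set of radii contains the nonpositive numbers; membership of \<open>0\<close> singles it out.\<close>

definition layer_radii :: "nat \<Rightarrow> (nat \<Rightarrow> real) \<Rightarrow> nat \<Rightarrow> real set" where
  "layer_radii N r k = (if k = N then {..<r N} else if k = 0 then {r 1<..} else {r (Suc k)<..<r k})"

lemma is_interval_layer_radii: "is_interval (layer_radii N r k)"
  by (auto simp: layer_radii_def is_interval_convex_1)

lemma open_layer_radii: "open (layer_radii N r k)"
  by (simp add: layer_radii_def)

lemma open_norm_in: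
  assumes "open I"
  shows "open {z :: complex. norm z \<in> I}"
  using open_vimage[OF assms, of norm] by (simp add: vimage_def continuous_on_norm_id)

lemma layer_radii_interior:
  assumes "1 \<le> N" "k \<le> N"
  shows "{z :: complex. norm z \<in> layer_radii N r k} \<subseteq> interior (layer N r k)"
proof (rule interior_maximal)
  show "{z :: complex. norm z \<in> layer_radii N r k} \<subseteq> layer N r k"
    using assms by (auto simp: layer_radii_def layer_def)
  show "open {z :: complex. norm z \<in> layer_radii N r k}"
    by (intro open_norm_in open_layer_radii)
qed

lemma concentric_disk_radius_pos:
  assumes "concentric_disk N r s" "k \<in> {1..N}"
  shows "0 < r k"
  using concentric_disk_props(1)[OF assms(1)] assms(2) by (cases k) auto

lemma conductivity_layer_radii:
  assumes "concentric_disk N r s" "k \<le> N" "norm z \<in> layer_radii N r k"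
  shows "conductivity N r s z = s k"
proof (rule conductivity_layer[OF assms(1,2)])
  have "1 \<le> N" using assms(1) by (simp add: concentric_disk_def)
  then show "z \<in> layer N r k"
    using layer_radii_interior[of N k r] assms(2,3) interior_subset by blast
qed

text \<open>The conductivity is constant on a layer, so it can be pulled out of the divergence and,
  being positive, cancelled.\<close>

lemma solution_harmonic:
  assumes disk: "concentric_disk N r s" and sol: "conductivity_solution N r s u" and k: "k \<le> N"
  shows "harmonic_on u {z :: complex. norm z \<in> layer_radii N r k}"
proof -
  define S where "S = {z :: complex. norm z \<in> layer_radii N r k}"
  have "1 \<le> N" "0 < s k" using disk k by (auto simp: concentric_disk_def)
  have S: "open S" unfolding S_def by (intro open_norm_in open_layer_radii)
  have sub: "S \<subseteq> interior (layer N r k)"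
    unfolding S_def by (rule layer_radii_interior) fact+
  have t: "twice_cont_diff_on u S"
    using sol k sub unfolding conductivity_solution_def twice_cont_diff_on_def
    by (meson continuous_on_subset subsetD)
  have "(\<Sum>b\<in>Basis. partial b (partial b u) x) = 0" if x: "x \<in> S" for x
  proof -
    have "partial b (\<lambda>y. conductivity N r s y *\<^sub>R partial b u y) x = s k *\<^sub>R partial b (partial b u) x"
      if "b \<in> Basis" for b
    proof -
      have "partial b (\<lambda>y. conductivity N r s y *\<^sub>R partial b u y) x
          = partial b (\<lambda>y. s k *\<^sub>R partial b u y) x"
        by (rule partial_cong_open[OF S x]) (simp add: S_def conductivity_layer_radii[OF disk k])
      also have "\<dots> = s k *\<^sub>R partial b (partial b u) x"
        by (rule partial_scaleR) (use t x that in \<open>auto simp: twice_cont_diff_on_def\<close>)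
      finally show ?thesis .
    qed
    then have "s k *\<^sub>R (\<Sum>b\<in>Basis. partial b (partial b u) x) = div_grad (conductivity N r s) u x"
      by (simp add: div_grad_def scaleR_sum_right)
    also have "\<dots> = 0"
      using sol k sub x by (auto simp: conductivity_solution_def)
    finally show ?thesis using \<open>0 < s k\<close> by simp
  qed
  with S t show ?thesis by (simp add: harmonic_on_def S_def)
qed

lemma layer_radii_around:
  assumes disk: "concentric_disk N r s" and k: "k \<in> {1..N}"
  obtains c d where "0 \<le> c" "c < r k" "r k < d"
    "{c<..<r k} \<subseteq> layer_radii N r k" "{r k<..<d} \<subseteq> layer_radii N r (k - 1)"
proof -
  have dec: "r (Suc j) < r j" if "j \<in> {1..<N}" for j
    using disk that by (simp add: concentric_disk_def)
  have outer: "r k < r (k - 1)" if "k \<noteq> 1"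
    using dec[of "k - 1"] k that by (cases k) auto
  \<comment> \<open>At the core, \<open>c = 0\<close> keeps the radii positive; outside,
    \<open>r 1 + 1\<close> is an arbitrary cut-off of the unbounded exterior.\<close>
  define c where "c = (if k = N then 0 else r (Suc k))"
  define d where "d = (if k = 1 then r 1 + 1 else r (k - 1))"
  have "0 \<le> c" "c < r k" "{c<..<r k} \<subseteq> layer_radii N r k"
    using concentric_disk_radius_pos[OF disk k] concentric_disk_radius_pos[OF disk, of "Suc k"]
      dec[of k] k
    by (auto simp: c_def layer_radii_def)
  moreover have "r k < d" "{r k<..<d} \<subseteq> layer_radii N r (k - 1)"
    using outer k by (auto simp: d_def layer_radii_def)
  ultimately show ?thesis using that by blast
qed

lemma continuous_on_radial_derivative:
  assumes "harmonic_on u S" "0 \<notin> S"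
  shows "continuous_on S (\<lambda>z. frechet_derivative u (at z) (sgn z))"
proof -
  have "continuous_on S (\<lambda>z. cnj (cnj (dzbar u z)))"
    by (intro continuous_intros holomorphic_on_imp_continuous_on cnj_dzbar_holomorphic assms)
  then have "continuous_on S (dzbar u)" by simp
  moreover have "continuous_on S (dz u)"
    by (intro holomorphic_on_imp_continuous_on dz_holomorphic assms)
  moreover have "continuous_on S (\<lambda>z :: complex. sgn z)"
    using assms(2) unfolding sgn_div_norm by (intro continuous_intros) auto
  ultimately have "continuous_on S (\<lambda>z. dz u z * sgn z + dzbar u z * cnj (sgn z))"
    by (intro continuous_on_add continuous_on_mult continuous_on_cnj)
  moreover have "frechet_derivative u (at z) (sgn z) = dz u z * sgn z + dzbar u z * cnj (sgn z)"
    if "z \<in> S" for z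
  proof -
    have "u differentiable (at z)"
      using assms(1) that by (auto simp: harmonic_on_def twice_cont_diff_on_def)
    from frechet_derivative_at[OF has_derivative_dz_dzbar[OF this]] show ?thesis by metis
  qed
  ultimately show ?thesis by (simp cong: continuous_on_cong)
qed

lemma value_match:
  assumes disk: "concentric_disk N r s" and sol: "conductivity_solution N r s u"
    and k: "k \<in> {1..N}" and cont: "isCont f (r k)" "isCont g (r k)"
    and f: "\<And>\<rho>. \<rho> \<in> layer_radii N r k \<Longrightarrow> 0 < \<rho> \<Longrightarrow> circle_coeff u \<rho> n = f \<rho>"
    and g: "\<And>\<rho>. \<rho> \<in> layer_radii N r (k - 1) \<Longrightarrow> 0 < \<rho> \<Longrightarrow> circle_coeff u \<rho> n = g \<rho>"
  shows "f (r k) = g (r k)"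
proof -
  obtain c d where cd: "0 \<le> c" "c < r k" "r k < d"
    "{c<..<r k} \<subseteq> layer_radii N r k" "{r k<..<d} \<subseteq> layer_radii N r (k - 1)"
    using layer_radii_around[OF disk k] by blast
  have "continuous_on {c<..<d} (\<lambda>\<rho>. circle_coeff u \<rho> n)"
    by (rule circle_coeff_continuous)
      (use sol cd(1) in \<open>auto simp: conductivity_solution_def intro: continuous_on_subset\<close>)
  then show ?thesis
  proof (rule continuous_glue[OF cd(2,3) _ cont])
    fix \<rho> assume \<rho>: "c < \<rho>" "\<rho> < r k"
    then have "\<rho> \<in> layer_radii N r k" using cd(4) by auto
    then show "circle_coeff u \<rho> n = f \<rho>" using f \<rho> cd(1) by simp
  next
    fix \<rho> assume \<rho>: "r k < \<rho>" "\<rho> < d"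
    then have "\<rho> \<in> layer_radii N r (k - 1)" using cd(5) by auto
    then show "circle_coeff u \<rho> n = g \<rho>" using g \<rho> cd(1,2) by simp
  qed
qed

text \<open>The radial derivative itself may fail to exist on the interface. The comparison is made
  for the continuous extension \<open>G\<close> of the flux, whose circle coefficients off the
  interface are the conductivity times those of the radial derivative.\<close>

lemma flux_match:
  assumes disk: "concentric_disk N r s" and sol: "conductivity_solution N r s u"
    and k: "k \<in> {1..N}" and cont: "isCont f (r k)" "isCont g (r k)"
    and f: "\<And>\<rho>. \<rho> \<in> layer_radii N r k \<Longrightarrow> 0 < \<rho> \<Longrightarrow>
      circle_coeff (\<lambda>z. frechet_derivative u (at z) (sgn z)) \<rho> n = f \<rho>"
    and g: "\<And>\<rho>. \<rho> \<in> layer_radii N r (k - 1) \<Longrightarrow> 0 < \<rho> \<Longrightarrow>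
      circle_coeff (\<lambda>z. frechet_derivative u (at z) (sgn z)) \<rho> n = g \<rho>"
  shows "complex_of_real (s k) * f (r k) = complex_of_real (s (k - 1)) * g (r k)"
proof -
  obtain c d where cd: "0 \<le> c" "c < r k" "r k < d"
    "{c<..<r k} \<subseteq> layer_radii N r k" "{r k<..<d} \<subseteq> layer_radii N r (k - 1)"
    using layer_radii_around[OF disk k] by blast
  define F where "F = normal_flux (conductivity N r s) u"
  define D where "D z = frechet_derivative u (at z) (sgn z)" for z
  have flux: "F z = complex_of_real (s j) * D z" if "j \<le> N" "norm z \<in> layer_radii N r j" for j z
    using conductivity_layer_radii[OF disk that]
    by (simp add: F_def D_def normal_flux_def scaleR_conv_of_real)
  have contF: "continuous_on {z :: complex. norm z \<in> I} F" if "j \<le> N" "I \<subseteq> layer_radii N r j" "0 \<notin> I" "open I" for j I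
  proof -
    have "harmonic_on u {z :: complex. norm z \<in> I}"
      by (rule harmonic_on_subset[OF solution_harmonic[OF disk sol that(1)]])
        (use that(2) open_norm_in[OF that(4)] in auto)
    then have "continuous_on {z :: complex. norm z \<in> I} D"
      unfolding D_def by (rule continuous_on_radial_derivative) (use that(3) in auto)
    then have "continuous_on {z :: complex. norm z \<in> I} (\<lambda>z. complex_of_real (s j) * D z)"
      by (intro continuous_intros)
    then show ?thesis
      by (rule continuous_on_eq) (use flux[OF that(1)] that(2) in auto)
  qed
  have left: "continuous_on {z :: complex. norm z \<in> {c<..<r k}} F"
    by (rule contF[of k]) (use k cd in auto)
  have right: "continuous_on {z :: complex. norm z \<in> {r k<..<d}} F"
    by (rule contF[of "k - 1"]) (use k cd in auto)
  have "continuous_on ({z :: complex. norm z \<in> {c<..<r k}} \<union> {z :: complex. norm z \<in> {r k<..<d}}) F"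
    by (rule continuous_on_open_Un[OF open_norm_in open_norm_in left right]) auto
  moreover have "{z :: complex. norm z \<in> {c<..<r k}} \<union> {z :: complex. norm z \<in> {r k<..<d}}
      = {z :: complex. norm z \<in> {c<..<d}} - sphere 0 (r k)"
    using cd(2,3) by auto
  ultimately have contU: "continuous_on ({z :: complex. norm z \<in> {c<..<d}} - sphere 0 (r k)) F" by simp
  have lim: "\<exists>L. (F \<longlongrightarrow> L) (at x within - sphere 0 (r k))"
    if "x \<in> {z :: complex. norm z \<in> {c<..<d}} \<inter> sphere 0 (r k)" for x
    using sol k that by (auto simp: conductivity_solution_def F_def)
  have int: "interior (sphere (0 :: complex) (r k)) = {}"
    using interior_mono[OF sphere_cball, of "0 :: complex" "r k"] interior_subset[of "sphere (0 :: complex) (r k)"]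
    by fastforce
  obtain G where G: "continuous_on {z :: complex. norm z \<in> {c<..<d}} G" "\<And>z. z \<notin> sphere 0 (r k) \<Longrightarrow> G z = F z"
    by (rule continuous_on_limit_extension[OF closed_sphere int open_norm_in contU lim]) auto
  have coeff: "circle_coeff G \<rho> n = complex_of_real (s j) * circle_coeff D \<rho> n"
    if "j \<le> N" "\<rho> \<in> layer_radii N r j" "0 < \<rho>" "\<rho> \<noteq> r k" for j \<rho>
    unfolding circle_coeff_cmult[symmetric]
    by (rule circle_coeff_cong) (use that G(2) flux in auto)
  have "continuous_on {c<..<d} (\<lambda>\<rho>. circle_coeff G \<rho> n)"
    by (rule circle_coeff_continuous[OF G(1)]) (use cd in auto)
  moreover have "isCont (\<lambda>\<rho>. complex_of_real (s k) * f \<rho>) (r k)"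
    "isCont (\<lambda>\<rho>. complex_of_real (s (k - 1)) * g \<rho>) (r k)"
    by (intro continuous_intros cont)+
  moreover have "circle_coeff G \<rho> n = complex_of_real (s k) * f \<rho>" if "c < \<rho>" "\<rho> < r k" for \<rho>
  proof -
    have "\<rho> \<in> layer_radii N r k" using that cd(4) by auto
    then show ?thesis using coeff[of k \<rho>] f[of \<rho>] that cd(1) k by (simp add: D_def[abs_def])
  qed
  moreover have "circle_coeff G \<rho> n = complex_of_real (s (k - 1)) * g \<rho>" if "r k < \<rho>" "\<rho> < d" for \<rho>
  proof -
    have "\<rho> \<in> layer_radii N r (k - 1)" using that cd(5) by auto
    moreover have "k - 1 \<le> N" "0 < \<rho>" "\<rho> \<noteq> r k" using k that cd(1,2) by auto
    ultimately show ?thesis using coeff[of "k - 1" \<rho>] g[of \<rho>] by (simp add: D_def[abs_def])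
  qed
  ultimately show ?thesis
    by (rule continuous_glue[OF cd(2,3)])
qed

lemma solution_modes:
  assumes disk: "concentric_disk N r s" and sol: "conductivity_solution N r s u"
    and m: "0 < m" "n = int m \<or> n = - int m"
  obtains A B where "transmission_system N r s m A B"
    "\<And>\<rho>. r 1 < \<rho> \<Longrightarrow> circle_coeff u \<rho> n = A 0 * complex_of_real \<rho> ^ m + B 0 / complex_of_real \<rho> ^ m"
proof -
  define D where "D z = frechet_derivative u (at z) (sgn z)" for z
  have N: "1 \<le> N" using disk by (simp add: concentric_disk_def)
  \<comment> \<open>Values, flux and regularity at 0 are bundled so that one choice of pairs, made
    for all layers at once, satisfies them together.\<close>
  define P where "P k A B \<longleftrightarrow> (\<forall>\<rho>\<in>layer_radii N r k. 0 < \<rho> \<longrightarrow>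
      circle_coeff u \<rho> n = A * complex_of_real \<rho> ^ m + B / complex_of_real \<rho> ^ m \<and>
      complex_of_real \<rho> * circle_coeff D \<rho> n
        = of_nat m * (A * complex_of_real \<rho> ^ m - B / complex_of_real \<rho> ^ m)) \<and>
      (0 \<in> layer_radii N r k \<longrightarrow> B = 0)" for k A B
  have "\<exists>A B. P k A B" if kN: "k \<le> N" for k
  proof -
    obtain A B where "\<And>\<rho>. \<rho> \<in> layer_radii N r k \<Longrightarrow> 0 < \<rho> \<Longrightarrow>
        circle_coeff u \<rho> n = A * complex_of_real \<rho> ^ m + B / complex_of_real \<rho> ^ m"
      "\<And>\<rho>. \<rho> \<in> layer_radii N r k \<Longrightarrow> 0 < \<rho> \<Longrightarrow> complex_of_real \<rho> * circle_coeff D \<rho> n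
        = of_nat m * (A * complex_of_real \<rho> ^ m - B / complex_of_real \<rho> ^ m)"
      "0 \<in> layer_radii N r k \<Longrightarrow> B = 0"
      by (rule harmonic_circle_modes[OF solution_harmonic[OF disk sol kN] is_interval_layer_radii m])
        (rule that; simp only: D_def[abs_def])
    then have "P k A B" by (simp add: P_def)
    then show ?thesis by blast
  qed
  then obtain A B where P: "\<And>k. k \<le> N \<Longrightarrow> P k (A k) (B k)"
    by metis
  have AB: "circle_coeff u \<rho> n = A k * complex_of_real \<rho> ^ m + B k / complex_of_real \<rho> ^ m"
    "complex_of_real \<rho> * circle_coeff D \<rho> n
      = of_nat m * (A k * complex_of_real \<rho> ^ m - B k / complex_of_real \<rho> ^ m)"
    if "k \<le> N" "\<rho> \<in> layer_radii N r k" "0 < \<rho>" for k \<rho>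
    using P that by (auto simp: P_def)
  have D: "circle_coeff D \<rho> n
      = of_nat m * (A k * complex_of_real \<rho> ^ m - B k / complex_of_real \<rho> ^ m) / complex_of_real \<rho>"
    if "k \<le> N" "\<rho> \<in> layer_radii N r k" "0 < \<rho>" for k \<rho>
    using AB(2)[OF that] that by (simp add: nonzero_eq_divide_eq mult.commute)
  have pos: "0 < r k" if "k \<in> {1..N}" for k
    using concentric_disk_radius_pos[OF disk that] .
  have BN: "B N = 0" using P[of N] pos[of N] N by (simp add: P_def layer_radii_def)
  have "A k * of_real (r (Suc k)) ^ m + B k / of_real (r (Suc k)) ^ m
        = A (Suc k) * of_real (r (Suc k)) ^ m + B (Suc k) / of_real (r (Suc k)) ^ m \<and>
      of_real (s k) * (A k * of_real (r (Suc k)) ^ m - B k / of_real (r (Suc k)) ^ m)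
        = of_real (s (Suc k)) * (A (Suc k) * of_real (r (Suc k)) ^ m - B (Suc k) / of_real (r (Suc k)) ^ m)"
    if "k < N" for k
  proof -
    define \<rho>k where "\<rho>k = r (Suc k)"
    have k: "Suc k \<in> {1..N}" "k \<le> N" "Suc k \<le> N" using that by auto
    have p: "0 < \<rho>k" using pos[OF k(1)] by (simp add: \<rho>k_def)
    define V where "V j \<rho> = A j * complex_of_real \<rho> ^ m + B j / complex_of_real \<rho> ^ m" for j \<rho>
    define W where "W j \<rho> = of_nat m * (A j * complex_of_real \<rho> ^ m - B j / complex_of_real \<rho> ^ m) / complex_of_real \<rho>"
      for j \<rho>
    have cont: "isCont (V j) \<rho>k" "isCont (W j) \<rho>k" for j
      unfolding V_def W_def using p by (auto intro!: continuous_intros)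
    have V: "V (Suc k) \<rho>k = V k \<rho>k" unfolding \<rho>k_def
      by (rule value_match[OF disk sol k(1) cont(1)[unfolded \<rho>k_def] cont(1)[unfolded \<rho>k_def], where n = n])
        (use AB(1) k in \<open>auto simp: V_def\<close>)
    have "of_real (s (Suc k)) * W (Suc k) \<rho>k = of_real (s (Suc k - 1)) * W k \<rho>k" unfolding \<rho>k_def
      by (rule flux_match[OF disk sol k(1) cont(2)[unfolded \<rho>k_def] cont(2)[unfolded \<rho>k_def], where n = n])
        (use D k in \<open>auto simp: W_def D_def[abs_def]\<close>)
    then have "of_nat m / of_real \<rho>k * (of_real (s (Suc k)) * (A (Suc k) * of_real \<rho>k ^ m - B (Suc k) / of_real \<rho>k ^ m))
        = of_nat m / of_real \<rho>k * (of_real (s k) * (A k * of_real \<rho>k ^ m - B k / of_real \<rho>k ^ m))"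
      by (simp add: W_def mult_ac)
    then have "of_real (s (Suc k)) * (A (Suc k) * of_real \<rho>k ^ m - B (Suc k) / of_real \<rho>k ^ m)
        = of_real (s k) * (A k * of_real \<rho>k ^ m - B k / of_real \<rho>k ^ m)"
      using p m(1) by (subst (asm) mult_cancel_left) auto
    with V show ?thesis by (simp add: V_def \<rho>k_def)
  qed
  with BN have "transmission_system N r s m A B" by (simp add: transmission_system_def)
  moreover have "circle_coeff u \<rho> n = A 0 * complex_of_real \<rho> ^ m + B 0 / complex_of_real \<rho> ^ m"
    if "r 1 < \<rho>" for \<rho>
    using AB(1)[of 0 \<rho>] that N pos[of 1] by (simp add: layer_radii_def)
  ultimately show ?thesis using that by blast
qed

text \<open>Conservation: \<open>\<rho>\<close> times the mean radial derivative is constant in each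
  layer, its product with the conductivity passes through interfaces, and it is 0 at the centre.
  This rules out a logarithm in the exterior.\<close>

lemma solution_total_flux:
  assumes disk: "concentric_disk N r s" and sol: "conductivity_solution N r s u" and "r 1 < \<rho>"
  shows "circle_coeff (\<lambda>z. frechet_derivative u (at z) (sgn z)) \<rho> 0 = 0"
proof -
  define D where "D z = frechet_derivative u (at z) (sgn z)" for z
  have N: "1 \<le> N" using disk by (simp add: concentric_disk_def)
  have pos: "0 < r k" if "k \<in> {1..N}" for k
    using concentric_disk_radius_pos[OF disk that] .
  have "\<exists>C. (\<forall>\<rho>\<in>layer_radii N r k. 0 < \<rho> \<longrightarrow> complex_of_real \<rho> * circle_coeff D \<rho> 0 = C) \<and>
      (0 \<in> layer_radii N r k \<longrightarrow> C = 0)" if kN: "k \<le> N" for k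
  proof -
    obtain \<alpha> \<beta> :: complex where "\<And>\<rho>. \<rho> \<in> layer_radii N r k \<Longrightarrow> 0 < \<rho> \<Longrightarrow> complex_of_real \<rho> * circle_coeff D \<rho> 0
        = \<alpha> * complex_of_real \<rho> powi 0 + \<beta> * complex_of_real \<rho> powi (- 0)"
      "0 \<in> layer_radii N r k \<Longrightarrow> \<alpha> = 0" "0 \<in> layer_radii N r k \<Longrightarrow> \<beta> = 0"
      by (rule harmonic_circle_coeffs[OF solution_harmonic[OF disk sol kN] is_interval_layer_radii, of 0])
        (rule that; simp only: D_def[abs_def])
    \<comment> \<open>At frequency 0 both powers are 1. In the core both \<alpha> and \<beta>
      vanish, since 0 is on both sides of the sign condition.\<close>
    then show ?thesis by (intro exI[of _ "\<alpha> + \<beta>"]) simp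
  qed
  then obtain C where C: "\<And>k \<rho>. k \<le> N \<Longrightarrow> \<rho> \<in> layer_radii N r k \<Longrightarrow> 0 < \<rho> \<Longrightarrow>
      complex_of_real \<rho> * circle_coeff D \<rho> 0 = C k"
    and C0: "\<And>k. k \<le> N \<Longrightarrow> 0 \<in> layer_radii N r k \<Longrightarrow> C k = 0"
    by metis
  have D: "circle_coeff D \<rho> 0 = C k / complex_of_real \<rho>"
    if "k \<le> N" "\<rho> \<in> layer_radii N r k" "0 < \<rho>" for k \<rho>
    using C[OF that] that by (simp add: field_simps)
  \<comment> \<open>Layers are numbered from outside, so the step from \<open>k\<close> to
    \<open>k - 1\<close> carries the vanishing from the core towards the exterior.\<close>
  have inward: "C (k - 1) = 0" if k: "k \<in> {1..N}" and "C k = 0" for k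
  proof -
    have "complex_of_real (s k) * (\<lambda>\<rho>. C k / complex_of_real \<rho>) (r k)
        = complex_of_real (s (k - 1)) * (\<lambda>\<rho>. C (k - 1) / complex_of_real \<rho>) (r k)"
      by (rule flux_match[OF disk sol k, where n = 0])
        (use pos[OF k] k D in \<open>auto intro!: continuous_intros simp: D_def[abs_def]\<close>)
    moreover have "0 < s (k - 1)" using disk k by (auto simp: concentric_disk_def)
    ultimately show ?thesis using pos[OF k] that(2) by simp
  qed
  have "C N = 0" using C0[of N] pos[of N] N by (simp add: layer_radii_def)
  have "C k = 0" if "k \<le> N" for k
    using that
  proof (induction k rule: inc_induct)
    case (step k)
    then show ?case using inward[of "Suc k"] by simp
  qed fact
  then have "C 0 = 0" by simp
  then show ?thesis
    using D[of 0 \<rho>] assms(3) N pos[of 1] by (simp add: layer_radii_def D_def[abs_def])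
qed

section \<open>Uniqueness of Fourier coefficients and power series\<close>

text \<open>On the circle a real linear function is a combination of \<open>cis t\<close> and
  \<open>cis (- t)\<close>, so multiplying by it shifts frequencies by one.\<close>

lemma circle_coeff_linear:
  fixes g :: "complex \<Rightarrow> real"
  assumes "continuous_on (sphere 0 r) F" "0 \<le> r" "bounded_linear g"
  shows "circle_coeff (\<lambda>z. F z * of_real (g z)) r n =
    of_real r * ((of_real (g 1) - \<i> * of_real (g \<i>)) / 2 * circle_coeff F r (n - 1)
      + (of_real (g 1) + \<i> * of_real (g \<i>)) / 2 * circle_coeff F r (n + 1))"
proof -
  interpret g: bounded_linear g by fact
  have greal: "g z = Re z * g 1 + Im z * g \<i>" for z
  proof -
    have "z = Re z *\<^sub>R 1 + Im z *\<^sub>R \<i>" by (simp add: complex_eq_iff)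
    then have "g z = g (Re z *\<^sub>R 1 + Im z *\<^sub>R \<i>)" by simp
    then show ?thesis by (simp only: g.add g.scaleR real_scaleR_def)
  qed
  have gcomplex: "complex_of_real (g z) = of_real (Re z) * of_real (g 1) + of_real (Im z) * of_real (g \<i>)" for z
    by (simp only: greal[of z] of_real_add of_real_mult)
  define c d where "c = of_real r * (of_real (g 1) - \<i> * of_real (g \<i>)) / 2"
    and "d = of_real r * (of_real (g 1) + \<i> * of_real (g \<i>)) / 2"
  have gz: "complex_of_real (g (rcis r t)) = c * cis t + d * cis (- t)" for t
    unfolding gcomplex[of "rcis r t"] by (simp add: c_def d_def complex_eq_iff field_simps)
  have "F (rcis r t) * of_real (g (rcis r t)) * cis (- (of_int n * t)) =
      c * (F (rcis r t) * cis (- (of_int (n - 1) * t))) + d * (F (rcis r t) * cis (- (of_int (n + 1) * t)))" for t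
  proof -
    have "cis (- (of_int (n - 1) * t)) = cis t * cis (- (of_int n * t))"
      "cis (- (of_int (n + 1) * t)) = cis (- t) * cis (- (of_int n * t))"
      by (simp_all add: cis_mult algebra_simps)
    then show ?thesis unfolding gz by (simp only: algebra_simps)
  qed
  then have "circle_coeff (\<lambda>z. F z * of_real (g z)) r n = integral {0..2*pi} (\<lambda>t.
      c * (F (rcis r t) * cis (- (of_int (n - 1) * t))) + d * (F (rcis r t) * cis (- (of_int (n + 1) * t))))"
    unfolding circle_coeff_def by (intro integral_cong) simp
  also have "\<dots> = c * circle_coeff F r (n - 1) + d * circle_coeff F r (n + 1)"
    using integral_add[OF integrable_on_mult_right[OF circle_coeff_integrable[OF assms(1,2), of "n - 1"]]
        integrable_on_mult_right[OF circle_coeff_integrable[OF assms(1,2), of "n + 1"]], of c d]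
    unfolding circle_coeff_def by simp
  finally show ?thesis by (simp add: c_def d_def algebra_simps)
qed

text \<open>\<open>F\<close> is generalised in the induction: for a product, the first factor is
  absorbed into \<open>F\<close>, which keeps all coefficients zero, before the second is
  applied.\<close>

lemma circle_coeff_real_polynomial_eq_0:
  assumes "real_polynomial_function g" "0 \<le> r"
    and "continuous_on (sphere 0 r) F" "\<And>n. circle_coeff F r n = 0"
  shows "circle_coeff (\<lambda>z. F z * of_real (g z)) r n = 0"
  using assms
proof (induction g arbitrary: F n rule: real_polynomial_function.induct)
  case (linear f)
  then show ?case by (simp add: circle_coeff_linear)
next
  case (const c)
  then show ?case using circle_coeff_cmult[of "of_real c" F r n] by (simp add: mult.commute)
next
  case (add f g)
  have "continuous_on (sphere 0 r) f" "continuous_on (sphere 0 r) g"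
    using add.hyps by (auto intro!: continuous_at_imp_continuous_on continuous_real_polymonial_function)
  then have "circle_coeff (\<lambda>z. F z * of_real (f z) + F z * of_real (g z)) r n = 0"
    using add by (subst circle_coeff_add) (auto intro!: continuous_intros)
  then show ?case by (simp add: ring_distribs)
next
  case (mult f g)
  have f: "continuous_on (sphere 0 r) f"
    using mult.hyps by (auto intro!: continuous_at_imp_continuous_on continuous_real_polymonial_function)
  have "circle_coeff (\<lambda>z. (F z * of_real (f z)) * of_real (g z)) r n = 0"
    by (rule mult.IH(2)) (use mult f in \<open>auto intro!: continuous_intros\<close>)
  then show ?case by (simp add: mult.assoc)
qed

text \<open>By Stone-Weierstrass \<open>cnj (F z)\<close> is uniformly close on the circle to
  \<open>p - \<i> * q\<close> with real polynomials \<open>p\<close>, \<open>q\<close>, and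
  \<open>F\<close> is orthogonal to these. Hence the integral of the square of \<open>norm F\<close>
  is arbitrarily small.\<close>

lemma circle_coeff_eq_0_imp_eq_0:
  assumes F: "continuous_on (sphere 0 r) F" and r: "0 \<le> r"
    and zero: "\<And>n. circle_coeff F r n = 0" and z: "norm z = r"
  shows "F z = 0"
proof -
  obtain C where C: "0 < C" "\<And>z. z \<in> sphere 0 r \<Longrightarrow> norm (F z) \<le> C"
    using compact_imp_bounded[OF compact_continuous_image[OF F compact_sphere]]
    unfolding bounded_pos by blast
  define E where "E = circle_coeff (\<lambda>z. F z * cnj (F z)) r 0"
  have "norm E \<le> 2 * pi * (C * (2 * e))" if e: "0 < e" for e
  proof -
    obtain p where p: "real_polynomial_function p" "\<And>x. x \<in> sphere 0 r \<Longrightarrow> \<bar>Re (F x) - p x\<bar> < e"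
      using Stone_Weierstrass_real_polynomial_function[OF compact_sphere continuous_on_Re[OF F] e] by blast
    obtain q where q: "real_polynomial_function q" "\<And>x. x \<in> sphere 0 r \<Longrightarrow> \<bar>Im (F x) - q x\<bar> < e"
      using Stone_Weierstrass_real_polynomial_function[OF compact_sphere continuous_on_Im[OF F] e] by blast
    have cont: "continuous_on (sphere 0 r) p" "continuous_on (sphere 0 r) q"
      using p(1) q(1) by (auto intro!: continuous_at_imp_continuous_on continuous_real_polymonial_function)
    define G where "G z = F z * (cnj (F z) - (of_real (p z) - \<i> * of_real (q z)))" for z
    have cG: "continuous_on (sphere 0 r) G"
      unfolding G_def by (intro continuous_intros F cont)
    define P Q where "P z = F z * of_real (p z)" and "Q z = \<i> * (F z * of_real (q z))" for z
    have cPQ: "continuous_on (sphere 0 r) P" "continuous_on (sphere 0 r) Q"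
      unfolding P_def Q_def by (intro continuous_intros F cont)+
    have "E = circle_coeff (\<lambda>z. G z + (P z - Q z)) r 0"
      unfolding E_def G_def P_def Q_def by (simp add: algebra_simps)
    also have "\<dots> = circle_coeff G r 0 + (circle_coeff P r 0 - circle_coeff Q r 0)"
      using cG cPQ r by (subst circle_coeff_add) (auto intro!: continuous_intros simp: circle_coeff_diff)
    also have "\<dots> = circle_coeff G r 0"
      using circle_coeff_real_polynomial_eq_0[OF p(1) r F zero]
        circle_coeff_real_polynomial_eq_0[OF q(1) r F zero]
      by (simp add: P_def[abs_def] Q_def[abs_def] circle_coeff_cmult)
    finally have "E = circle_coeff G r 0" .
    moreover have "norm (circle_coeff G r 0) \<le> 2 * pi * (C * (2 * e))"
    proof (rule norm_circle_coeff_le[OF _ r])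
      show "continuous_on (sphere 0 r) G" by fact
      fix z :: complex assume z: "norm z = r"
      have "cnj (F z) - (of_real (p z) - \<i> * of_real (q z))
          = of_real (Re (F z) - p z) - \<i> * of_real (Im (F z) - q z)"
        by (simp add: complex_eq_iff)
      then have "norm (cnj (F z) - (of_real (p z) - \<i> * of_real (q z)))
          \<le> norm (complex_of_real (Re (F z) - p z)) + norm (\<i> * complex_of_real (Im (F z) - q z))"
        using norm_triangle_ineq4 by metis
      also have "\<dots> \<le> 2 * e"
        using p(2)[of z] q(2)[of z] z unfolding norm_mult norm_of_real by simp
      finally show "norm (G z) \<le> C * (2 * e)"
        unfolding G_def norm_mult using C z by (intro mult_mono) auto
    qed
    ultimately show ?thesis by simp
  qed
  from this[of "e / (2 * pi * C * 2)" for e] have "norm E \<le> 0 + e" if "0 < e" for e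
    using that C(1) by (simp add: field_simps)
  then have E: "E = 0" using field_le_epsilon[of "norm E" 0] by simp
  define h where "h t = (norm (F (rcis r t)))\<^sup>2" for t
  have hc: "continuous_on T h" for T
    unfolding h_def by (intro continuous_intros continuous_on_circle F r)
  have "E = integral {0..2*pi} (\<lambda>t. of_real (h t))"
    unfolding E_def circle_coeff_def h_def by (simp add: complex_norm_square del: of_real_power)
  also have "\<dots> = of_real (integral {0..2*pi} h)"
    by (rule integral_unique[OF has_integral_of_real[OF integrable_integral[OF integrable_continuous_real[OF hc]]]])
  finally have "integral {0..2*pi} h = 0" using E by simp
  moreover have "0 \<le> h t" for t by (simp add: h_def)
  ultimately have h0: "h t = 0" if "t \<in> {0..2*pi}" for t
    using integral_eq_0_iff[OF hc, of 0 "2 * pi"] that by simp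
  \<comment> \<open>\<open>Arg2pi\<close> takes its values in the interval over which the
    coefficients are integrated.\<close>
  have "z = rcis r (Arg2pi z)" "Arg2pi z \<in> {0..2*pi}"
    using z Arg2pi[of z] by (simp_all add: rcis_def cis_conv_exp is_Arg_def)
  with h0[of "Arg2pi z"] show ?thesis by (simp add: h_def)
qed

lemma circle_coeff_power:
  assumes "0 < r"
  shows "circle_coeff (\<lambda>z. z ^ i) r n = (if n = int i then 2 * pi * of_real r ^ i else 0)"
proof (cases "n = int i")
  case True
  have "cis t ^ i * cis (- (of_int n * t)) = cis (of_nat i * t) * cis (- (of_nat i * t))" for t
    by (simp add: True Complex.DeMoivre)
  then have "cis t ^ i * cis (- (of_int n * t)) = 1" for t
    by (simp only: cis_mult add.right_inverse cis_zero)
  then have "rcis r t ^ i * cis (- (of_int n * t)) = of_real r ^ i" for t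
    by (simp add: rcis_def power_mult_distrib mult.assoc)
  then show ?thesis by (simp add: circle_coeff_def True scaleR_conv_of_real)
next
  case False
  define k :: real where "k = of_int (int i - n)"
  have k: "k \<noteq> 0" using False by (simp add: k_def)
  have "((\<lambda>t. cis (k * t)) has_integral (cis (k * (2 * pi)) / (\<i> * k) - cis (k * 0) / (\<i> * k))) {0..2*pi}"
    by (rule fundamental_theorem_of_calculus)
      (use k in \<open>auto intro!: derivative_eq_intros simp: has_vector_derivative_def scaleR_conv_of_real mult_ac\<close>)
  moreover have "cis (k * (2 * pi)) = 1"
    using cis_multiple_2pi[of k] by (simp add: k_def mult_ac)
  ultimately have zero: "((\<lambda>t. cis (k * t)) has_integral 0) {0..2*pi}"
    by simp
  have "cis t ^ i * cis (- (of_int n * t)) = cis (k * t)" for t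
    unfolding Complex.DeMoivre cis_mult k_def by (simp add: algebra_simps)
  then have "rcis r t ^ i * cis (- (of_int n * t)) = of_real r ^ i * cis (k * t)" for t
    by (simp add: rcis_def power_mult_distrib mult.assoc)
  then show ?thesis using False by (simp add: circle_coeff_def integral_unique[OF zero])
qed

text \<open>Partial sums beyond \<open>nat n\<close> already have the claimed coefficient by
  orthogonality, and they converge uniformly on the closed disk because the series converges
  everywhere.\<close>

lemma circle_coeff_power_series:
  fixes c :: "nat \<Rightarrow> complex"
  assumes sums: "\<And>z. (\<lambda>i. c i * z ^ i) sums H z" and H: "continuous_on UNIV H" and r: "0 < r"
  shows "circle_coeff H r n = (if 0 \<le> n then 2 * pi * c (nat n) * of_real r ^ nat n else 0)" (is "_ = ?X")
proof -
  have "conv_radius c = \<infinity>"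
    by (rule conv_radius_inftyI'') (rule sums_summable[OF sums])
  then have unif: "uniform_limit (cball 0 r) (\<lambda>k z. \<Sum>i<k. c i * z ^ i) H sequentially"
    using powser_uniform_limit[of r c 0] sums_unique[OF sums, symmetric] by simp
  define P where "P k z = (\<Sum>i<k. c i * z ^ i)" for k z
  have cP: "continuous_on (sphere 0 r) (P k)" for k
    unfolding P_def by (intro continuous_intros)
  have cH: "continuous_on (sphere 0 r) H" by (rule continuous_on_subset[OF H]) simp
  have coeff: "circle_coeff (P k) r n = ?X" if "nat n < k" for k
  proof -
    have "circle_coeff (P k) r n = (\<Sum>i<k. circle_coeff (\<lambda>z. c i * z ^ i) r n)"
    proof (induction k)
      case (Suc k)
      have "circle_coeff (P (Suc k)) r n = circle_coeff (\<lambda>z. P k z + c k * z ^ k) r n"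
        by (simp add: P_def[abs_def])
      also have "\<dots> = circle_coeff (P k) r n + circle_coeff (\<lambda>z. c k * z ^ k) r n"
        using r cP[of k] by (intro circle_coeff_add continuous_intros) auto
      finally show ?case using Suc by simp
    qed (simp add: P_def[abs_def] circle_coeff_def)
    also have "\<dots> = (\<Sum>i<k. if i = nat n \<and> 0 \<le> n then c i * (2 * pi * of_real r ^ i) else 0)"
      using r by (intro sum.cong) (auto simp: circle_coeff_cmult circle_coeff_power)
    also have "\<dots> = ?X" using that by (cases "0 \<le> n") (simp_all add: mult_ac)
    finally show ?thesis .
  qed
  have "norm (circle_coeff H r n - ?X) \<le> 0 + e" if e: "0 < e" for e
  proof -
    have "\<forall>\<^sub>F k in sequentially. \<forall>z\<in>cball 0 r. dist (P k z) (H z) < e / (2 * pi)"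
      using uniform_limitD[OF unif, of "e / (2 * pi)"] e by (simp add: P_def)
    with eventually_gt_at_top[of "nat n"]
    have "\<forall>\<^sub>F k in sequentially. nat n < k \<and> (\<forall>z\<in>cball 0 r. dist (P k z) (H z) < e / (2 * pi))"
      by eventually_elim simp
    then obtain k where k: "nat n < k" "\<And>z. norm z \<le> r \<Longrightarrow> dist (P k z) (H z) < e / (2 * pi)"
      by (auto simp: eventually_sequentially)
    have "circle_coeff H r n - ?X = circle_coeff (\<lambda>z. H z - P k z) r n"
      unfolding coeff[OF k(1), symmetric] using r by (intro circle_coeff_diff[symmetric] cH cP) auto
    moreover have "norm (circle_coeff (\<lambda>z. H z - P k z) r n) \<le> 2 * pi * (e / (2 * pi))"
      using r k(2) by (intro norm_circle_coeff_le continuous_intros cH cP) (auto simp: dist_norm norm_minus_commute less_imp_le)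
    ultimately show ?thesis by simp
  qed
  then have "norm (circle_coeff H r n - ?X) \<le> 0" by (rule field_le_epsilon)
  then show ?thesis by simp
qed

section \<open>Recovery of the layers\<close>

text \<open>Multiplying by the inverse of \<open>\<rho> ^ m\<close> isolates \<open>c\<close>, while
  the other terms tend to 0.\<close>

lemma leading_coefficient_zero:
  fixes c d :: complex
  assumes "0 < m" "\<And>\<rho>. R < \<rho> \<Longrightarrow> f \<rho> = c * of_real \<rho> ^ m + d / of_real \<rho> ^ m"
    and lim: "(f \<longlongrightarrow> 0) at_top"
  shows "c = 0"
proof -
  have inv: "((\<lambda>\<rho>. complex_of_real (inverse \<rho>)) \<longlongrightarrow> of_real 0) at_top"
    by (intro tendsto_of_real tendsto_inverse_0_at_top filterlim_ident)
  have "((\<lambda>\<rho>. f \<rho> * of_real (inverse \<rho>) ^ m - d * of_real (inverse \<rho>) ^ m * of_real (inverse \<rho>) ^ m)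
      \<longlongrightarrow> 0 * of_real 0 ^ m - d * of_real 0 ^ m * of_real 0 ^ m) at_top"
    by (intro tendsto_intros lim inv)
  moreover have "\<forall>\<^sub>F \<rho> in at_top. f \<rho> * of_real (inverse \<rho>) ^ m
      - d * of_real (inverse \<rho>) ^ m * of_real (inverse \<rho>) ^ m = c"
    using eventually_gt_at_top[of "max R 0"]
  proof eventually_elim
    case (elim \<rho>)
    then show ?case using assms(2)[of \<rho>] by (simp add: field_simps)
  qed
  ultimately have "((\<lambda>_ :: real. c) \<longlongrightarrow> 0) at_top"
    using assms(1) by (simp add: tendsto_cong zero_power)
  then show ?thesis by (simp add: tendsto_const_iff)
qed

lemma circle_coeff_decay:
  assumes "continuous_on UNIV F"
    and "F \<in> O[at_infinity](\<lambda>x. complex_of_real (inverse (norm x)))"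
  shows "((\<lambda>\<rho>. circle_coeff F \<rho> n) \<longlongrightarrow> 0) at_top"
proof -
  obtain c where c: "0 < c" "\<forall>\<^sub>F x in at_infinity. norm (F x) \<le> c * norm (complex_of_real (inverse (norm x)))"
    using landau_o.bigE[OF assms(2)] by blast
  then obtain b where b: "\<And>x. b \<le> norm x \<Longrightarrow> norm (F x) \<le> c * norm (complex_of_real (inverse (norm x)))"
    by (auto simp: eventually_at_infinity)
  have "\<forall>\<^sub>F \<rho> in at_top. norm (circle_coeff F \<rho> n) \<le> 2 * pi * (c * inverse \<rho>)"
    using eventually_ge_at_top[of "max b 0"]
  proof eventually_elim
    case (elim \<rho>)
    show ?case
    proof (rule norm_circle_coeff_le)
      show "continuous_on (sphere 0 \<rho>) F" using assms(1) by (rule continuous_on_subset) simp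
      show "0 \<le> \<rho>" using elim by simp
      show "norm (F z) \<le> c * inverse \<rho>" if "norm z = \<rho>" for z
        using b[of z] that elim by (simp add: norm_inverse)
    qed
  qed
  moreover have "((\<lambda>\<rho>. 2 * pi * (c * inverse \<rho>)) \<longlongrightarrow> 0) at_top"
    by (intro tendsto_mult_right_zero tendsto_inverse_0_at_top filterlim_ident)
  ultimately show ?thesis by (rule Lim_null_comparison)
qed

text \<open>Used to see that an open set containing all layers has its frontier strictly outside the
  outermost circle.\<close>

lemma cball_subset_layers:
  assumes "concentric_disk N r s" "norm z \<le> r 1"
  shows "z \<in> (\<Union>k\<in>{1..N}. layer N r k)"
proof -
  have N: "1 \<le> N" using assms(1) by (simp add: concentric_disk_def)
  have "\<exists>j\<in>{1..N}. z \<in> layer N r j" if "k \<le> N" "1 \<le> k" "norm z \<le> r k" for k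
    using that
  proof (induction k rule: inc_induct)
    case base
    then show ?case using N by (intro bexI[of _ N]) (auto simp: layer_def)
  next
    case (step k)
    show ?case
    proof (cases "norm z \<le> r (Suc k)")
      case True
      then show ?thesis using step by simp
    next
      case False
      then show ?thesis using step by (intro bexI[of _ k]) (auto simp: layer_def)
    qed
  qed
  from this[of 1] N assms(2) show ?thesis by auto
qed

text \<open>At both signs the decay identifies the growing coefficient with that of
  \<open>H\<close>. At \<open>- int m\<close> it is 0, and then uniqueness for one mode removes the
  decaying part as well.\<close>

lemma solution_exterior:
  assumes disk: "concentric_disk N r s" and sol: "conductivity_solution N r s u"
    and H: "continuous_on UNIV H"
    and decay: "(\<lambda>x. u x - H x) \<in> O[at_infinity](\<lambda>x. complex_of_real (inverse (norm x)))"
    and m: "0 < m"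
    and pos: "\<And>\<rho>. 0 < \<rho> \<Longrightarrow> circle_coeff H \<rho> (int m) = h * of_real \<rho> ^ m"
    and neg: "\<And>\<rho>. 0 < \<rho> \<Longrightarrow> circle_coeff H \<rho> (- int m) = 0"
  shows "\<exists>A B. transmission_system N r s m A B \<and> A 0 = h \<and>
    (\<forall>\<rho>>r 1. circle_coeff u \<rho> (int m) = A 0 * of_real \<rho> ^ m + B 0 / of_real \<rho> ^ m
      \<and> circle_coeff u \<rho> (- int m) = 0)"
proof -
  have u: "continuous_on UNIV u" using sol by (simp add: conductivity_solution_def)
  have "1 \<le> N" using disk by (simp add: concentric_disk_def)
  then have r1: "0 < r 1" using concentric_disk_radius_pos[OF disk, of 1] by simp
  have lim: "((\<lambda>\<rho>. circle_coeff (\<lambda>x. u x - H x) \<rho> n) \<longlongrightarrow> 0) at_top" for n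
    by (intro circle_coeff_decay continuous_intros u H decay)
  have diff: "circle_coeff (\<lambda>x. u x - H x) \<rho> n = circle_coeff u \<rho> n - circle_coeff H \<rho> n"
    if "0 < \<rho>" for \<rho> n
    by (intro circle_coeff_diff continuous_on_subset[OF u] continuous_on_subset[OF H]) (use that in auto)
  obtain A B where AB: "transmission_system N r s m A B"
    "\<And>\<rho>. r 1 < \<rho> \<Longrightarrow> circle_coeff u \<rho> (int m) = A 0 * complex_of_real \<rho> ^ m + B 0 / complex_of_real \<rho> ^ m"
    using solution_modes[OF disk sol m, of "int m"] by blast
  have "A 0 - h = 0"
  proof (rule leading_coefficient_zero[OF m _ lim, of "r 1" "int m" _ "B 0"])
    fix \<rho> assume "r 1 < \<rho>"
    then show "circle_coeff (\<lambda>x. u x - H x) \<rho> (int m) = (A 0 - h) * of_real \<rho> ^ m + B 0 / of_real \<rho> ^ m"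
      using AB(2)[of \<rho>] diff[of \<rho> "int m"] pos[of \<rho>] r1 by (simp add: left_diff_distrib)
  qed
  then have "A 0 = h" by simp
  obtain A' B' where AB': "transmission_system N r s m A' B'"
    "\<And>\<rho>. r 1 < \<rho> \<Longrightarrow> circle_coeff u \<rho> (- int m) = A' 0 * complex_of_real \<rho> ^ m + B' 0 / complex_of_real \<rho> ^ m"
    using solution_modes[OF disk sol m, of "- int m"] by blast
  have "A' 0 = 0"
    by (rule leading_coefficient_zero[OF m _ lim, of "r 1" "- int m" _ "B' 0"])
      (use AB'(2) diff neg r1 in simp)
  moreover have "B' 0 = 0" by (rule transmission_system_zero[OF disk AB'(1) m]) fact
  ultimately have "circle_coeff u \<rho> (- int m) = 0" if "r 1 < \<rho>" for \<rho>
    using AB'(2)[OF that] by simp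
  with AB \<open>A 0 = h\<close> show ?thesis
    by (intro exI[of _ A] exI[of _ B]) simp
qed

text \<open>With \<open>dz D = 0\<close> the conjugate of \<open>D\<close> is holomorphic, and the
  complement of a disk is connected, so the identity theorem applies. The limit point need only lie
  in the exterior, not in \<Gamma>.\<close>

lemma harmonic_identity:
  assumes harm: "harmonic_on D {z. norm z \<in> {R<..}}"
    and dz: "\<And>z. R < norm z \<Longrightarrow> dz D z = 0"
    and lim: "\<xi> islimpt \<Gamma>" "R < norm \<xi>" and \<Gamma>: "\<And>z. z \<in> \<Gamma> \<Longrightarrow> R < norm z \<and> D z = 0"
    and z: "R < norm z"
  shows "D z = 0"
proof -
  define E where "E = {z :: complex. R < norm z}"
  have E: "E = - cball 0 R" by (auto simp: E_def)
  have "(\<lambda>z. cnj (D z)) field_differentiable (at w)" if "w \<in> E" for w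
  proof -
    have "D differentiable (at w)"
      using harm that by (auto simp: harmonic_on_def twice_cont_diff_on_def E_def)
    from has_derivative_dz_dzbar[OF this]
    have "(D has_derivative (\<lambda>h. dzbar D w * cnj h)) (at w)"
      using dz that by (simp add: E_def)
    from bounded_linear.has_derivative[OF bounded_linear_cnj this]
    have "((\<lambda>z. cnj (D z)) has_field_derivative cnj (dzbar D w)) (at w)"
      by (simp add: has_field_derivative_def)
    then show ?thesis by (auto simp: field_differentiable_def)
  qed
  then have "(\<lambda>z. cnj (D z)) holomorphic_on E"
    by (auto simp: holomorphic_on_def field_differentiable_at_within)
  moreover have "open E" "connected E"
    unfolding E by (auto intro!: connected_complement_bounded_convex)
  ultimately have "cnj (D z) = 0"
    by (rule analytic_continuation[where U = \<Gamma> and \<xi> = \<xi>]) (use lim \<Gamma> z in \<open>auto simp: E_def\<close>)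
  then show ?thesis by simp
qed

theorem theorem5p4:
  fixes N :: nat
    and r1 r2 s1 s2 :: "nat \<Rightarrow> real"
    and a :: "nat \<Rightarrow> complex"
    and H u1 u2 :: "complex \<Rightarrow> complex"
    and \<Omega> \<Gamma> :: "complex set"
  assumes disk1: "concentric_disk N r1 s1"
    and disk2: "concentric_disk N r2 s2"
    and H_harmonic: "harmonic_on H UNIV"
    and H_series: "\<And>r \<theta>. 0 \<le> r \<Longrightarrow>
      (\<lambda>m. a (Suc m) * complex_of_real r ^ Suc m * exp (\<i> * of_nat (Suc m) * complex_of_real \<theta>))
        sums H (rcis r \<theta>)"
    and a_nonzero: "\<forall>\<^sub>F n in sequentially. a n \<noteq> 0"
    and u1_solution: "conductivity_solution N r1 s1 u1"
    and u1_decay: "(\<lambda>x. u1 x - H x) \<in> O[at_infinity](\<lambda>x. complex_of_real (inverse (norm x)))"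
    and u2_solution: "conductivity_solution N r2 s2 u2"
    and u2_decay: "(\<lambda>x. u2 x - H x) \<in> O[at_infinity](\<lambda>x. complex_of_real (inverse (norm x)))"
    and domain: "open \<Omega>" "connected \<Omega>" "bounded \<Omega>"
    and encloses: "(\<Union>k\<in>{1..N}. layer N r1 k) \<union> (\<Union>k\<in>{1..N}. layer N r2 k) \<subseteq> \<Omega>"
    and Gamma_open: "openin (top_of_set (frontier \<Omega>)) \<Gamma>"
    and Gamma_infinite: "infinite \<Gamma>"
    and agree: "\<And>x. x \<in> \<Gamma> \<Longrightarrow> u1 x = u2 x"
  shows "\<forall>k\<in>{1..N}. r1 k = r2 k \<and> s1 k = s2 k"
proof -
  have H: "continuous_on UNIV H"
    using H_harmonic
    by (auto simp: harmonic_on_def twice_cont_diff_on_def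
        intro!: continuous_at_imp_continuous_on differentiable_imp_continuous_within)
  \<comment> \<open>The given series starts at the first power; \<open>c 0 = 0\<close> supplies the
    missing constant term, whatever \<open>a 0\<close> is.\<close>
  define c where "c n = (if n = 0 then 0 else a n)" for n
  have "(\<lambda>n. c n * z ^ n) sums H z" for z
  proof -
    have "exp (\<i> * of_nat (Suc m) * complex_of_real t) = cis t ^ Suc m" for m t
      unfolding Complex.DeMoivre by (simp add: cis_conv_exp mult_ac)
    then have "(\<lambda>m. a (Suc m) * (complex_of_real (norm z) ^ Suc m * cis (Arg z) ^ Suc m)) sums H (rcis (norm z) (Arg z))"
      using H_series[of "norm z" "Arg z"] by (simp only: mult.assoc norm_ge_zero)
    then have "(\<lambda>m. c (Suc m) * z ^ Suc m) sums H z"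
      by (simp only: power_mult_distrib[symmetric] rcis_def[symmetric] rcis_cmod_Arg c_def nat.distinct if_False)
    from sums_Suc[OF this] show ?thesis by (simp add: c_def)
  qed
  note H_coeff = circle_coeff_power_series[OF this H]
  have H_pos: "circle_coeff H \<rho> (int m) = 2 * pi * a m * of_real \<rho> ^ m" if "0 < m" "0 < \<rho>" for m \<rho>
    using H_coeff[OF that(2), of "int m"] that by (simp add: c_def)
  have H_neg: "circle_coeff H \<rho> (- int m) = 0" if "0 < m" "0 < \<rho>" for m \<rho>
    using H_coeff[OF that(2), of "- int m"] that by simp
  define R where "R = max (r1 1) (r2 1)"
  have R12: "r1 1 \<le> R" "r2 1 \<le> R" by (simp_all add: R_def)
  have N: "1 \<le> N" using disk1 by (simp add: concentric_disk_def)
  have R: "0 < R"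
    using concentric_disk_radius_pos[OF disk1, of 1] N by (simp add: R_def)
  define P where "P r s u m A B \<longleftrightarrow> transmission_system N r s m A B \<and> A 0 = 2 * pi * a m \<and>
      (\<forall>\<rho>>R. circle_coeff u \<rho> (int m) = A 0 * of_real \<rho> ^ m + B 0 / of_real \<rho> ^ m
        \<and> circle_coeff u \<rho> (- int m) = 0)" for r s u m A B
  have exterior: "\<exists>A B. P r s u m A B"
    if u: "concentric_disk N r s" "conductivity_solution N r s u"
      "(\<lambda>x. u x - H x) \<in> O[at_infinity](\<lambda>x. complex_of_real (inverse (norm x)))" and r: "r 1 \<le> R" and m: "0 < m"
    for r s u m
  proof -
    have "\<exists>A B. transmission_system N r s m A B \<and> A 0 = 2 * pi * a m \<and>
      (\<forall>\<rho>>r 1. circle_coeff u \<rho> (int m) = A 0 * of_real \<rho> ^ m + B 0 / of_real \<rho> ^ m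
        \<and> circle_coeff u \<rho> (- int m) = 0)"
      by (rule solution_exterior[OF u(1,2) H u(3) m H_pos[OF m] H_neg[OF m]])
    then obtain A B where "transmission_system N r s m A B \<and> A 0 = 2 * pi * a m \<and>
      (\<forall>\<rho>>r 1. circle_coeff u \<rho> (int m) = A 0 * of_real \<rho> ^ m + B 0 / of_real \<rho> ^ m
        \<and> circle_coeff u \<rho> (- int m) = 0)" by (elim exE)
    then have "P r s u m A B" using r by (simp add: P_def)
    then show ?thesis by blast
  qed
  obtain A1 B1 where P1: "\<And>m. 0 < m \<Longrightarrow> P r1 s1 u1 m (A1 m) (B1 m)"
    using exterior[OF disk1 u1_solution u1_decay R12(1)] by metis
  obtain A2 B2 where P2: "\<And>m. 0 < m \<Longrightarrow> P r2 s2 u2 m (A2 m) (B2 m)"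
    using exterior[OF disk2 u2_solution u2_decay R12(2)] by metis
  note P1 = P1[unfolded P_def] and P2 = P2[unfolded P_def]

  define D where "D z = u1 z - u2 z" for z
  have harm1: "harmonic_on u1 {z. norm z \<in> {R<..}}"
    by (rule harmonic_on_subset[OF solution_harmonic[OF disk1 u1_solution, of 0]])
      (use N open_norm_in[of "{R<..}"] in \<open>auto simp: layer_radii_def R_def\<close>)
  have harm2: "harmonic_on u2 {z. norm z \<in> {R<..}}"
    by (rule harmonic_on_subset[OF solution_harmonic[OF disk2 u2_solution, of 0]])
      (use N open_norm_in[of "{R<..}"] in \<open>auto simp: layer_radii_def R_def\<close>)
  have harmD: "harmonic_on D {z. norm z \<in> {R<..}}"
    unfolding D_def by (rule harmonic_on_diff[OF harm1 harm2])
  have contu: "continuous_on UNIV u1" "continuous_on UNIV u2"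
    using u1_solution u2_solution by (auto simp: conductivity_solution_def)
  have coeffD: "circle_coeff D \<rho> n = circle_coeff u1 \<rho> n - circle_coeff u2 \<rho> n" if "R < \<rho>" for \<rho> n
    unfolding D_def using that R
    by (intro circle_coeff_diff continuous_on_subset[OF contu(1)] continuous_on_subset[OF contu(2)]) auto
  have radialD: "circle_coeff (\<lambda>z. frechet_derivative D (at z) (sgn z)) \<rho> 0 = 0" if "R < \<rho>" for \<rho>
  proof -
    have "frechet_derivative D (at z) (sgn z)
        = frechet_derivative u1 (at z) (sgn z) - frechet_derivative u2 (at z) (sgn z)" if "norm z = \<rho>" for z
      using partial_diff[of u1 z u2 "sgn z"] harm1 harm2 that \<open>R < \<rho>\<close>
      by (auto simp: D_def[abs_def] partial_def harmonic_on_def twice_cont_diff_on_def)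
    then have "circle_coeff (\<lambda>z. frechet_derivative D (at z) (sgn z)) \<rho> 0
        = circle_coeff (\<lambda>z. frechet_derivative u1 (at z) (sgn z) - frechet_derivative u2 (at z) (sgn z)) \<rho> 0"
      using that R by (intro circle_coeff_cong) auto
    also have "\<dots> = circle_coeff (\<lambda>z. frechet_derivative u1 (at z) (sgn z)) \<rho> 0
        - circle_coeff (\<lambda>z. frechet_derivative u2 (at z) (sgn z)) \<rho> 0"
      using that R
      by (intro circle_coeff_diff continuous_on_subset[OF continuous_on_radial_derivative[OF harm1]]
          continuous_on_subset[OF continuous_on_radial_derivative[OF harm2]]) auto
    also have "\<dots> = 0"
      using solution_total_flux[OF disk1 u1_solution, of \<rho>] solution_total_flux[OF disk2 u2_solution, of \<rho>] that
      by (simp add: R_def)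
    finally show ?thesis .
  qed
  have limD: "((\<lambda>\<rho>. circle_coeff D \<rho> n) \<longlongrightarrow> 0) at_top" for n
  proof -
    have "D \<in> O[at_infinity](\<lambda>x. complex_of_real (inverse (norm x)))"
      using sum_in_bigo(2)[OF u1_decay u2_decay] by (simp add: D_def[abs_def])
    moreover have "continuous_on UNIV D" unfolding D_def by (intro continuous_intros contu)
    ultimately show ?thesis by (intro circle_coeff_decay)
  qed
  have interval: "is_interval {R<..}" by (simp add: is_interval_convex_1)
  have zdz: "circle_coeff (\<lambda>z. z * dz D z) \<rho> n = 0" if \<rho>: "R < \<rho>" for \<rho> n
  proof -
    obtain \<alpha> \<beta> where
      coeffs: "\<And>r. r \<in> {R<..} \<Longrightarrow> 0 < r \<Longrightarrow> circle_coeff (\<lambda>z. z * dz D z) r n = \<alpha> * complex_of_real r powi n"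
      "\<And>r. r \<in> {R<..} \<Longrightarrow> 0 < r \<Longrightarrow>
        of_int n * circle_coeff D r n = \<alpha> * complex_of_real r powi n - \<beta> * complex_of_real r powi (- n)"
      "\<And>r. r \<in> {R<..} \<Longrightarrow> 0 < r \<Longrightarrow>
        complex_of_real r * circle_coeff (\<lambda>z. frechet_derivative D (at z) (sgn z)) r n
          = \<alpha> * complex_of_real r powi n + \<beta> * complex_of_real r powi (- n)"
      by (rule harmonic_circle_coeffs[OF harmD interval, of n]) (rule that; simp only:)
    \<comment> \<open>For \<open>n > 0\<close>, \<alpha> multiplies the growing power and decay
      kills it. For \<open>n = 0\<close>, the tangential identity gives
      \<open>\<alpha> = \<beta>\<close> and the vanishing flux \<open>\<alpha> = - \<beta>\<close>.
      For \<open>n < 0\<close> neither solution has that frequency, so the growing \<beta> vanishes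
      and then \<alpha>.\<close>
    have "\<alpha> = 0"
    proof (cases n "0 :: int" rule: linorder_cases)
      case greater
      then obtain m where m: "0 < m" "n = int m" using zero_less_imp_eq_int by auto
      have "((\<lambda>\<rho>. of_int n * circle_coeff D \<rho> n) \<longlongrightarrow> of_int n * 0) at_top"
        by (intro tendsto_intros limD)
      then show ?thesis
        by (intro leading_coefficient_zero[OF m(1), of R "\<lambda>\<rho>. of_int n * circle_coeff D \<rho> n" \<alpha> "- \<beta>"])
          (use coeffs(2) R in \<open>simp_all add: m(2) power_int_minus divide_inverse\<close>)
    next
      case equal
      then show ?thesis
        using coeffs(2,3)[of \<rho>] radialD[OF \<rho>] \<rho> R by simp
    next
      case less
      then have m: "0 < nat (- n)" "n = - int (nat (- n))" by auto
      define m where "m = nat (- n)"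
      note m = m[folded m_def]
      have "circle_coeff D \<rho> n = 0" if "R < \<rho>" for \<rho>
        using coeffD[OF that] P1[OF m(1)] P2[OF m(1)] m(2) that by simp
      then have *: "\<alpha> / complex_of_real \<rho> ^ m - \<beta> * complex_of_real \<rho> ^ m = 0" if "R < \<rho>" for \<rho>
        using coeffs(2)[of \<rho>] that R by (simp add: m(2) power_int_minus divide_inverse)
      have "\<beta> = 0"
        by (rule leading_coefficient_zero[OF m(1), of R "\<lambda>_. 0" \<beta> "- \<alpha>"])
          (use * in \<open>simp_all add: algebra_simps\<close>)
      then show ?thesis using *[OF \<rho>] \<rho> R by simp
    qed
    then show ?thesis using coeffs(1)[of \<rho>] \<rho> R by simp
  qed
  have dzD: "dz D z = 0" if z: "R < norm z" for z
  proof -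
    have "continuous_on (sphere 0 (norm z)) (dz D)"
      by (rule continuous_on_subset[OF holomorphic_on_imp_continuous_on[OF dz_holomorphic[OF harmD]]])
        (use z in auto)
    then have "z * dz D z = 0"
      by (intro circle_coeff_eq_0_imp_eq_0[of "norm z" "\<lambda>z. z * dz D z"] continuous_intros zdz z) auto
    then show ?thesis using z R by auto
  qed

  have \<Gamma>sub: "\<Gamma> \<subseteq> frontier \<Omega>" using Gamma_open openin_imp_subset by auto
  have front: "R < norm z" if "z \<in> frontier \<Omega>" for z
  proof (rule ccontr)
    assume "\<not> R < norm z"
    then have "z \<in> \<Omega>"
      using cball_subset_layers[OF disk1, of z] cball_subset_layers[OF disk2, of z] encloses
      by (auto simp: R_def)
    with that domain(1) show False by (auto simp: frontier_def interior_open)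
  qed
  \<comment> \<open>The limit point comes from compactness of the frontier. It may lie outside
    \<Gamma>, but as a frontier point it is in the exterior.\<close>
  obtain \<xi> where \<xi>: "\<xi> \<in> frontier \<Omega>" "\<xi> islimpt \<Gamma>"
    using Heine_Borel_imp_Bolzano_Weierstrass[OF compact_frontier_bounded[OF domain(3)] Gamma_infinite \<Gamma>sub]
    by blast
  have "D z = 0" if "R < norm z" for z
    by (rule harmonic_identity[OF harmD dzD \<xi>(2) front[OF \<xi>(1)] _ that])
      (use front \<Gamma>sub agree in \<open>auto simp: D_def\<close>)
  then have coeff_eq: "circle_coeff u1 \<rho> n = circle_coeff u2 \<rho> n" if "R < \<rho>" for \<rho> n
    using that R by (intro circle_coeff_cong) (auto simp: D_def)
  obtain \<rho>0 where \<rho>0: "R < \<rho>0" using gt_ex by blast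
  \<comment> \<open>The coefficients \<open>A\<close> already agree, both being
    \<open>2 * pi * a m\<close>, so equality on a single circle gives equality of the
    \<open>B\<close>.\<close>
  have same: "A1 m 0 = A2 m 0 \<and> B1 m 0 = B2 m 0" if "0 < m" for m
    using coeff_eq[OF \<rho>0, of "int m"] \<rho>0 P1[OF that] P2[OF that] R by simp
  show ?thesis
  proof (rule transmission_identification[OF disk1 disk2])
    show "transmission_system N r1 s1 m (A1 m) (B1 m)" "transmission_system N r2 s2 m (A2 m) (B2 m)"
      if "0 < m" for m
      using P1[OF that] P2[OF that] by auto
  next
    show "\<forall>\<^sub>F m in sequentially. A1 m 0 \<noteq> 0"
      using a_nonzero eventually_gt_at_top[of 0] by eventually_elim (simp add: P1)
    show "\<forall>\<^sub>F m in sequentially. A1 m 0 = A2 m 0 \<and> B1 m 0 = B2 m 0"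
      using eventually_gt_at_top[of 0] by eventually_elim (simp add: same)
  qed
qed

end
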